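(* Consider independent particles on $\mathbb{Z}$ in an i.i.d. space-time environment with admissible steps $0$ and $1$, as described in the context. Let $\{\eta_0(x):x\in\mathbb{Z}\}$ be distributed, given $\omega$, as independent Poisson variables with means $f(T_{x,0}\omega)$, $x\in\mathbb{Z}$. Assume the averaged jump probabilities are $p(0)=p(1)=1/2$, so that $v=1/2$. Then for $t\ge s>0$, $$\lim_{n\to\infty}\frac1{\sqrt n}\,\mathrm{Cov}_{\mathbb{P}}\bigl(E^\omega Y_n(s,0),E^\omega Y_n(t,0)\bigr)=\frac1{2\sqrt{2\pi}}\Bigl(\tfrac14\alpha^{-1}-1\Bigr)\bigl(\sqrt t+\sqrt s-\sqrt{t-s}\,\bigr).$$
   Context: Environment. $d=1$ and steps are $0$ or $1$: $\omega=(\omega_{x,s})_{(x,s)\in\mathbb{Z}\times\mathbb{Z}}$ with $\omega_{x,s}\in[0,1]$ the probability that a walk at $x$ at time $s$ jumps to $x+1$ at time $s+1$, and $1-\omega_{x,s}$ the probability that it stays at $x$. Under $\mathbb{P}$ (expectation $\mathbb{E}$) the variables $\omega_{x,s}$ are i.i.d., and $\mathbb{P}\{0<\omega_{0,0}<1\}>0$. The averaged jump probabilities are $p(1)=\mathbb{E}\omega_{0,0}$, $p(0)=1-p(1)$; $v=p(1)$; $\alpha=\mathbb{E}[\omega_{0,0}(1-\omega_{0,0})]$. $(T_{x,s}\omega)_{y,t}=\omega_{x+y,s+t}$, and $\pi^\omega_{s,t}(x,y)$ is the quenched transition probability from $(x,s)$ to $(y,t)$. Density. $f_N(\omega)=\sum_{z\in\mathbb{Z}}\pi^\omega_{-N,0}(z,0)$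 is a nonnegative martingale and $f=\lim_{N\to\infty}f_N$ ($\mathbb{P}$-a.s.); $\mathbb{E}f=1$, $\mathbb{E}(f^2)<\infty$, and $f$ depends only on levels $s\le-1$ of $\omega$. Particles. Given $\omega$, the walks $X^{x,j}_\bullet$ ($x\in\mathbb{Z},j\in\mathbb{N}$), $X^{x,j}_0=x$, evolve independently, each walk located at site $y$ at time $s$ jumping to $y+1$ at time $s+1$ with probability $\omega_{y,s}$ and staying at $y$ with probability $1-\omega_{y,s}$, and are independent of $\eta_0$; $E^\omega$ is expectation over $\eta_0$ and the walks for fixed $\omega$. Current. $$Y_n(t,r)=\sum_{x>0}\sum_{j=1}^{\eta_0(x)}\mathbf{1}\{X^{x,j}_{\lfloor nt\rfloor}\le\lfloor nvt\rfloor+\lfloor r\sqrt n\rfloor\}-\sum_{x\le0}\sum_{j=1}^{\eta_0(x)}\mathbf{1}\{X^{x,j}_{\lfloor nt\rfloor}>\lfloor nvt\rfloor+\lfloor r\sqrt n\rfloor\}.$$ *)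

theory Defs
  imports "HOL-Probability.Probability"
begin

text \<open>Site \<open>(x, s)\<close> carries the probability that a walk at \<open>x\<close> at time \<open>s\<close> is at \<open>x + 1\<close> at
  time \<open>s + 1\<close>; otherwise it is at \<open>x\<close>.\<close>

type_synonym env = "int \<times> int \<Rightarrow> real"

locale iid_environment = prob_space P for P :: "env measure" +
  assumes sets_env: "sets P = sets (PiM UNIV (\<lambda>_. restrict_space borel {0..1}))"
    and indep_env: "indep_vars (\<lambda>_. borel) (\<lambda>i \<omega>. \<omega> i) UNIV"
    and ident_env: "\<And>i. distr P borel (\<lambda>\<omega>. \<omega> i) = distr P borel (\<lambda>\<omega>. \<omega> (0, 0))"
    and nondegenerate: "measure P {\<omega> \<in> space P. 0 < \<omega> (0, 0) \<and> \<omega> (0, 0) < 1} > 0"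

definition p_one :: "env measure \<Rightarrow> real" where
  "p_one P = (\<integral>\<omega>. \<omega> (0, 0) \<partial>P)"

definition p_zero :: "env measure \<Rightarrow> real" where
  "p_zero P = 1 - p_one P"

definition speed :: "env measure \<Rightarrow> real" where
  "speed P = p_one P"

definition alpha :: "env measure \<Rightarrow> real" where
  "alpha P = (\<integral>\<omega>. \<omega> (0, 0) * (1 - \<omega> (0, 0)) \<partial>P)"

definition shift :: "int \<Rightarrow> int \<Rightarrow> env \<Rightarrow> env" where
  "shift x s \<omega> = (\<lambda>(y, t). \<omega> (x + y, s + t))"

definition jump :: "env \<Rightarrow> int \<Rightarrow> int \<Rightarrow> int pmf" where
  "jump \<omega> y s = map_pmf (\<lambda>b. if b then y + 1 else y) (bernoulli_pmf (\<omega> (y, s)))"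

text \<open>Law of the position, after \<open>k\<close> steps, of the walk that starts at \<open>x\<close> at time \<open>s\<close>.\<close>

primrec quenched_walk :: "env \<Rightarrow> int \<Rightarrow> int \<Rightarrow> nat \<Rightarrow> int pmf" where
  "quenched_walk \<omega> s x 0 = return_pmf x"
| "quenched_walk \<omega> s x (Suc k) =
     bind_pmf (quenched_walk \<omega> s x k) (\<lambda>y. jump \<omega> y (s + int k))"

text \<open>The transition probability \<open>\<pi>\<^sup>\<omega>\<^bsub>s,t\<^esub>(x, y)\<close>, for \<open>s \<le> t\<close>.\<close>

definition quenched_prob :: "env \<Rightarrow> int \<Rightarrow> int \<Rightarrow> int \<Rightarrow> int \<Rightarrow> real" where
  "quenched_prob \<omega> s t x y = pmf (quenched_walk \<omega> s x (nat (t - s))) y"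

definition f_approx :: "nat \<Rightarrow> env \<Rightarrow> real" where
  "f_approx N \<omega> = (\<Sum>\<^sub>\<infinity>z\<in>UNIV. quenched_prob \<omega> (- int N) 0 z 0)"

text \<open>The limit exists almost surely only; on the exceptional null set the value is immaterial.\<close>

definition f_density :: "env \<Rightarrow> real" where
  "f_density \<omega> = lim (\<lambda>N. f_approx N \<omega>)"

text \<open>\<^const>\<open>poisson_pmf\<close> needs a positive rate; the Poisson law with mean \<open>0\<close> is the point mass
  at \<open>0\<close>.\<close>

definition poisson_law :: "real \<Rightarrow> nat pmf" where
  "poisson_law m = (if 0 < m then poisson_pmf m else return_pmf 0)"

text \<open>A single walk is driven by a field of independent coins, one for each space-time point: if it
  is at \<open>y\<close> at time \<open>k\<close>, it jumps iff the coin at \<open>(y, k)\<close> shows \<^const>\<open>True\<close>. Since time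
  increases strictly, no coin is used twice, so under \<open>coin_law \<omega>\<close> the process \<open>walk x\<close> is the
  Markov chain with transition law \<open>jump \<omega> y k\<close>.\<close>

type_synonym coins = "int \<times> nat \<Rightarrow> bool"

definition coin_law :: "env \<Rightarrow> coins measure" where
  "coin_law \<omega> = PiM UNIV (\<lambda>(y, k). measure_pmf (bernoulli_pmf (\<omega> (y, int k))))"

primrec walk :: "int \<Rightarrow> coins \<Rightarrow> nat \<Rightarrow> int" where
  "walk x B 0 = x"
| "walk x B (Suc k) = (if B (walk x B k, k) then walk x B k + 1 else walk x B k)"

text \<open>The quenched law of the particle system. A sample is a pair \<open>(\<eta>, C)\<close> of initial occupation
  numbers and of one private coin field \<open>C (x, j)\<close> for every walk.\<close>

definition quenched_law :: "env \<Rightarrow> ((int \<Rightarrow> nat) \<times> (int \<times> nat \<Rightarrow> coins)) measure" where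
  "quenched_law \<omega> =
     PiM UNIV (\<lambda>x. measure_pmf (poisson_law (f_density (shift x 0 \<omega>))))
       \<Otimes>\<^sub>M PiM UNIV (\<lambda>_. coin_law \<omega>)"

text \<open>The current for occupation numbers \<open>\<eta>\<close> and paths \<open>X x j\<close>. As the steps of the paths are
  \<open>0\<close> or \<open>1\<close>, only finitely many \<open>x\<close> contribute to each of the two sums.\<close>

definition current ::
  "real \<Rightarrow> nat \<Rightarrow> real \<Rightarrow> real \<Rightarrow> (int \<Rightarrow> nat) \<Rightarrow> (int \<Rightarrow> nat \<Rightarrow> nat \<Rightarrow> int) \<Rightarrow> real" where
  "current v n t r \<eta> X =
     (\<Sum>\<^sub>\<infinity>x\<in>{0<..}. \<Sum>j=1..\<eta> x.
        of_bool (X x j (nat \<lfloor>real n * t\<rfloor>) \<le> \<lfloor>real n * v * t\<rfloor> + \<lfloor>r * sqrt (real n)\<rfloor>))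
   - (\<Sum>\<^sub>\<infinity>x\<in>{..0}. \<Sum>j=1..\<eta> x.
        of_bool (X x j (nat \<lfloor>real n * t\<rfloor>) > \<lfloor>real n * v * t\<rfloor> + \<lfloor>r * sqrt (real n)\<rfloor>))"

text \<open>The quenched mean \<open>E\<^sup>\<omega> Y\<^sub>n(t, r)\<close>.\<close>

definition quenched_mean_current :: "real \<Rightarrow> nat \<Rightarrow> real \<Rightarrow> real \<Rightarrow> env \<Rightarrow> real" where
  "quenched_mean_current v n t r \<omega> =
     (\<integral>(\<eta>, C). current v n t r \<eta> (\<lambda>x j. walk x (C (x, j))) \<partial>quenched_law \<omega>)"

definition covariance :: "'a measure \<Rightarrow> ('a \<Rightarrow> real) \<Rightarrow> ('a \<Rightarrow> real) \<Rightarrow> real" where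
  "covariance M A B =
     (\<integral>w. (A w - (\<integral>w'. A w' \<partial>M)) * (B w - (\<integral>w'. B w' \<partial>M)) \<partial>M)"

end

theory Submission
  imports Defs "HOL-Real_Asymp.Real_Asymp"
begin

text \<open>
  The current is a height function. For a configuration with mean number \<open>\<phi> y\<close> of particles at
  site \<open>y\<close>, let \<open>h\<close> be a profile with \<open>h x - h (x - 1) = \<phi> x\<close>. A time step replaces \<open>h x\<close> by
  \<open>(1 - \<omega> (x, s)) * h x + \<omega> (x, s) * h (x - 1)\<close>, because a fraction \<open>\<omega> (x, s)\<close> of the particles at
  \<open>x\<close> leaves. Both the quenched distribution functions of single walks and the quenched mean current
  obey this linear recursion, so the quenched mean current up to time \<open>m\<close> past \<open>L\<close> is the height at
  \<open>(L, m)\<close> of the profile whose initial increments are the densities \<open>f (T\<^bsub>x,0\<^esub> \<omega>)\<close>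
  (\<open>quenched_mean_current_eq\<close>).

  Let \<open>G\<close> be the height minus its mean \<open>L - m / 2\<close>. The environment at level \<open>m\<close> is independent of
  \<open>G\<close> at time \<open>m\<close>, and this gives a closed recursion for second moments (\<open>evolve_step\<close>): it involves
  only \<open>E (G x)\<^sup>2\<close> and the gaps \<open>E (G x - G y)\<^sup>2\<close>. With \<open>\<sigma>\<^sup>2 = 1 / (4 \<alpha>) - 1\<close> the gap function
  \<open>\<sigma>\<^sup>2 \<bar>x - y\<bar>\<close> is a fixed point, and for this gap function the variance of \<open>G\<close> satisfies exactly the
  averaging recursion \<open>V (x, m + 1) = (V (x, m) + V (x - 1, m)) / 2\<close>: the noise added in a step
  cancels the loss caused by averaging. Hence, for every fixed base point,
  \<open>E (G (y, m + k) - G (x, m))\<^sup>2 = \<sigma>\<^sup>2 E \<bar>y - x - S\<^sub>k\<bar>\<close> with \<open>S\<^sub>k\<close> binomial with parameters \<open>k\<close> and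
  \<open>1 / 2\<close> (\<open>fluctuation_increment\<close>). Polarisation turns this into a formula for the covariance without
  error term, and \<open>E \<bar>S\<^sub>k - k / 2\<bar> \<sim> sqrt (k / (2 \<pi>))\<close>, which is Wallis' product, gives the limit
  (\<open>mean_abs_asymptotics\<close>).

  It remains to see that the initial densities have the gap function \<open>\<sigma>\<^sup>2 \<bar>x - y\<bar>\<close>, in other words
  that they have variance \<open>\<sigma>\<^sup>2\<close> and are uncorrelated. The approximation \<open>f\<^sub>N\<close> of the density is the
  increment of the profile that is flat at time \<open>-N\<close>. As \<open>N\<close> grows this is a martingale for the
  levels counted backwards in time (\<open>flat_increment_orthogonal\<close>), bounded in \<open>L\<^sup>2\<close>, so it converges
  almost surely by a maximal inequality (\<open>bounded_martingale_convergence\<close>) and in \<open>L\<^sup>2\<close>. Its gap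
  functions are the iterates of the gap recursion from \<open>0\<close>, and these increase to the fixed point:
  the deficit stays convex and nonnegative, and a nonzero limit of the deficit would grow quadratically,
  whereas it is at most linear (\<open>flat_gap_limit\<close>).
\<close>

section \<open>Square integrable functions\<close>

definition square_integrable :: "'a measure \<Rightarrow> ('a \<Rightarrow> real) \<Rightarrow> bool" where
  "square_integrable M X \<longleftrightarrow> X \<in> borel_measurable M \<and> integrable M (\<lambda>\<omega>. (X \<omega>)\<^sup>2)"

lemma square_integrable_measurable:
  "square_integrable M X \<Longrightarrow> X \<in> borel_measurable M"
  by (simp add: square_integrable_def)

lemma square_integrable_power2:
  "square_integrable M X \<Longrightarrow> integrable M (\<lambda>\<omega>. (X \<omega>)\<^sup>2)"
  by (simp add: square_integrable_def)

text \<open>Young's inequality bounds the product by the sum of the squares.\<close>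

lemma integrable_mult_square_integrable:
  assumes "square_integrable M X" "square_integrable M Y"
  shows "integrable M (\<lambda>\<omega>. X \<omega> * Y \<omega>)"
proof (rule Bochner_Integration.integrable_bound)
  show "integrable M (\<lambda>\<omega>. (X \<omega>)\<^sup>2 + (Y \<omega>)\<^sup>2)"
    using assms by (auto intro: square_integrable_power2)
  show "(\<lambda>\<omega>. X \<omega> * Y \<omega>) \<in> borel_measurable M"
    using assms by (auto dest!: square_integrable_measurable)
  have "\<bar>a * b\<bar> \<le> a\<^sup>2 + b\<^sup>2" for a b :: real
  proof -
    have "2 * \<bar>a * b\<bar> \<le> a\<^sup>2 + b\<^sup>2"
      using zero_le_power2[of "\<bar>a\<bar> - \<bar>b\<bar>"] by (simp add: power2_diff abs_mult)
    moreover have "0 \<le> \<bar>a * b\<bar>" by simp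
    ultimately show ?thesis by linarith
  qed
  then show "AE \<omega> in M. norm (X \<omega> * Y \<omega>) \<le> norm ((X \<omega>)\<^sup>2 + (Y \<omega>)\<^sup>2)"
    by auto
qed

lemma square_integrable_add:
  assumes "square_integrable M X" "square_integrable M Y"
  shows "square_integrable M (\<lambda>\<omega>. X \<omega> + Y \<omega>)"
  unfolding square_integrable_def power2_sum mult.assoc
  using assms integrable_mult_square_integrable[OF assms]
  by (intro conjI borel_measurable_add Bochner_Integration.integrable_add
      integrable_mult_right square_integrable_measurable square_integrable_power2)

lemma square_integrable_cmult:
  assumes "square_integrable M X"
  shows "square_integrable M (\<lambda>\<omega>. c * X \<omega>)"
  using assms by (auto simp: square_integrable_def power_mult_distrib)

lemma square_integrable_diff:
  assumes "square_integrable M X" "square_integrable M Y"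
  shows "square_integrable M (\<lambda>\<omega>. X \<omega> - Y \<omega>)"
  using square_integrable_add[OF assms(1) square_integrable_cmult[OF assms(2), of "-1"]] by simp

lemma (in finite_measure) square_integrable_const: "square_integrable M (\<lambda>_. c)"
  by (simp add: square_integrable_def)

lemma square_integrable_mult_bounded:
  assumes "square_integrable M X" "Y \<in> borel_measurable M"
    and "\<And>\<omega>. \<omega> \<in> space M \<Longrightarrow> \<bar>Y \<omega>\<bar> \<le> c"
  shows "square_integrable M (\<lambda>\<omega>. Y \<omega> * X \<omega>)"
  unfolding square_integrable_def
proof
  show "(\<lambda>\<omega>. Y \<omega> * X \<omega>) \<in> borel_measurable M"
    using assms by (auto dest!: square_integrable_measurable)
  then have meas: "(\<lambda>\<omega>. (Y \<omega> * X \<omega>)\<^sup>2) \<in> borel_measurable M"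
    by (rule borel_measurable_power)
  have "norm ((Y \<omega> * X \<omega>)\<^sup>2) \<le> norm (c\<^sup>2 * (X \<omega>)\<^sup>2)" if "\<omega> \<in> space M" for \<omega>
  proof -
    have "(Y \<omega>)\<^sup>2 \<le> c\<^sup>2"
      using assms(3)[OF that] by (intro abs_le_square_iff[THEN iffD1]) linarith
    then show ?thesis
      by (simp add: power_mult_distrib mult_right_mono)
  qed
  then show "integrable M (\<lambda>\<omega>. (Y \<omega> * X \<omega>)\<^sup>2)"
    by (intro Bochner_Integration.integrable_bound[OF
          integrable_mult_right[OF square_integrable_power2[OF assms(1)], of "c\<^sup>2"] meas] AE_I2)
qed

lemma (in finite_measure) square_integrable_bounded:
  assumes "Y \<in> borel_measurable M" "\<And>\<omega>. \<omega> \<in> space M \<Longrightarrow> \<bar>Y \<omega>\<bar> \<le> c"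
  shows "square_integrable M Y"
  using square_integrable_mult_bounded[OF square_integrable_const[of 1] assms] by simp

lemma (in finite_measure) integrable_square_integrable:
  "square_integrable M X \<Longrightarrow> integrable M X"
  by (auto simp: square_integrable_def intro: square_integrable_imp_integrable)

section \<open>Independence of functions of disjoint sets of coordinates\<close>

text \<open>The \<open>\<sigma>\<close>-algebra of the coordinates in \<open>A\<close>, on the space of all functions. It does not refer to a
probability measure, so measurability of an expression in given coordinates is left to the
measurability prover, and \<open>indep_var_coord_algebra\<close> turns it into independence.\<close>

definition coord_algebra :: "'b measure \<Rightarrow> 'i set \<Rightarrow> ('i \<Rightarrow> 'b) measure" where
  "coord_algebra N A = vimage_algebra UNIV (\<lambda>\<omega>. restrict \<omega> A) (PiM A (\<lambda>_. N))"

lemma space_coord_algebra [simp]: "space (coord_algebra N A) = UNIV"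
  by (simp add: coord_algebra_def)

lemma measurable_restrict_coord_algebra:
  assumes "space N = UNIV"
  shows "(\<lambda>\<omega>. restrict \<omega> A) \<in> coord_algebra N A \<rightarrow>\<^sub>M PiM A (\<lambda>_. N)"
  unfolding coord_algebra_def
  by (rule measurable_vimage_algebra1) (use assms in \<open>auto simp: space_PiM PiE_def\<close>)

lemma measurable_coord_algebra_coordinate:
  assumes "space N = UNIV" "i \<in> A"
  shows "(\<lambda>\<omega>. \<omega> i) \<in> coord_algebra N A \<rightarrow>\<^sub>M N"
proof -
  have "(\<lambda>f. f i) \<circ> (\<lambda>\<omega>. restrict \<omega> A) \<in> coord_algebra N A \<rightarrow>\<^sub>M N"
    by (rule measurable_comp[OF measurable_restrict_coord_algebra[OF assms(1)]
          measurable_component_singleton[OF assms(2)]])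
  then show ?thesis
    using assms(2) by (simp add: comp_def)
qed

lemma measurable_from_coord_algebra:
  assumes "space N = UNIV" "\<And>i. i \<in> A \<Longrightarrow> (\<lambda>\<omega>. \<omega> i) \<in> M \<rightarrow>\<^sub>M N"
    and "X \<in> coord_algebra N A \<rightarrow>\<^sub>M K"
  shows "X \<in> M \<rightarrow>\<^sub>M K"
proof -
  have "(\<lambda>\<omega>. restrict \<omega> A) \<in> M \<rightarrow>\<^sub>M PiM A (\<lambda>_. N)"
    by (rule measurable_restrict) (use assms(2) in auto)
  then have "(\<lambda>\<omega>. \<omega>) \<in> M \<rightarrow>\<^sub>M coord_algebra N A"
    unfolding coord_algebra_def by (intro measurable_vimage_algebra2) auto
  from measurable_comp[OF this assms(3)] show ?thesis
    by (simp add: comp_def)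
qed

lemma measurable_coord_algebra_mono:
  assumes "space N = UNIV" "A \<subseteq> B" "X \<in> coord_algebra N A \<rightarrow>\<^sub>M K"
  shows "X \<in> coord_algebra N B \<rightarrow>\<^sub>M K"
  by (rule measurable_from_coord_algebra[OF assms(1) _ assms(3)])
     (use assms in \<open>auto intro: measurable_coord_algebra_coordinate\<close>)

text \<open>Preimages under a \<open>coord_algebra N A\<close>-measurable function are preimages under the restriction to
\<open>A\<close>, so independence is inherited from the restrictions to \<open>A\<close> and \<open>B\<close>.\<close>

lemma indep_var_coord_algebra:
  fixes M :: "('i \<Rightarrow> 'b) measure"
  assumes "prob_space M" and M: "prob_space.indep_vars M (\<lambda>_. N) (\<lambda>i \<omega>. \<omega> i) UNIV" and N: "space N = UNIV"
    and X: "X \<in> coord_algebra N A \<rightarrow>\<^sub>M K" and Y: "Y \<in> coord_algebra N B \<rightarrow>\<^sub>M L"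
    and AB: "A \<inter> B = {}"
  shows "prob_space.indep_var M K X L Y"
proof -
  interpret prob_space M by fact
  let ?G = "\<lambda>A. sigma_sets (space M) {(\<lambda>\<omega>. restrict \<omega> A) -` C \<inter> space M |C. C \<in> sets (PiM A (\<lambda>_. N))}"
  have rv: "\<And>i. (\<lambda>\<omega>. \<omega> i) \<in> M \<rightarrow>\<^sub>M N"
    using M by (auto simp: indep_vars_def)
  have *: "indep_var (PiM A (\<lambda>_. N)) (\<lambda>\<omega>. restrict \<omega> A) (PiM B (\<lambda>_. N)) (\<lambda>\<omega>. restrict \<omega> B)"
    using indep_var_restrict[OF M AB] by simp
  have sub: "sigma_sets (space M) {Z -` C \<inter> space M |C. C \<in> sets J} \<subseteq> ?G D"
    if Z: "Z \<in> coord_algebra N D \<rightarrow>\<^sub>M J" for Z D and J :: "'e measure"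
  proof (rule sigma_sets_mono, safe)
    fix C assume C: "C \<in> sets J"
    have "Z -` C \<in> sets (coord_algebra N D)"
      using measurable_sets[OF Z C] by simp
    then obtain E where "E \<in> sets (PiM D (\<lambda>_. N))" "Z -` C = (\<lambda>\<omega>. restrict \<omega> D) -` E"
      unfolding coord_algebra_def
      by (subst (asm) sets_vimage_algebra2) (use N in \<open>auto simp: space_PiM PiE_def\<close>)
    then show "Z -` C \<inter> space M \<in> ?G D"
      by (auto intro!: sigma_sets.Basic)
  qed
  have "indep_set (?G A) (?G B)"
    using * unfolding indep_var_eq by simp
  then have "indep_set (sigma_sets (space M) {X -` C \<inter> space M |C. C \<in> sets K})
      (sigma_sets (space M) {Y -` C \<inter> space M |C. C \<in> sets L})"
    unfolding indep_set_def
    by (rule indep_sets_mono_sets) (use sub[OF X] sub[OF Y] in \<open>auto split: bool.split\<close>)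
  moreover have "X \<in> M \<rightarrow>\<^sub>M K" "Y \<in> M \<rightarrow>\<^sub>M L"
    using rv X Y by (auto intro: measurable_from_coord_algebra[OF N])
  ultimately show ?thesis
    unfolding indep_var_eq by simp
qed

section \<open>Convergence of square integrable martingales\<close>

text \<open>Pythagoras for martingale increments: \<open>X n\<close> itself is an admissible test function. The martingale
property is expressed, here and below, by testing increments against bounded functions of the past,
which avoids conditional expectations; \<open>F n\<close> need not live on the sample space of \<open>M\<close>.\<close>

lemma (in prob_space) bounded_martingale_orthogonal:
  fixes X :: "nat \<Rightarrow> 'a \<Rightarrow> real"
  assumes meas: "\<And>n. X n \<in> borel_measurable M"
    and adapted: "\<And>n k. k \<le> n \<Longrightarrow> X k \<in> borel_measurable (F n)"
    and bounded: "\<And>n \<omega>. \<omega> \<in> space M \<Longrightarrow> \<bar>X n \<omega>\<bar> \<le> B n"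
    and orth: "\<And>n m Z c. n \<le> m \<Longrightarrow> Z \<in> borel_measurable (F n) \<Longrightarrow> Z \<in> borel_measurable M \<Longrightarrow>
      (\<And>\<omega>. \<omega> \<in> space M \<Longrightarrow> \<bar>Z \<omega>\<bar> \<le> c) \<Longrightarrow> expectation (\<lambda>\<omega>. (X m \<omega> - X n \<omega>) * Z \<omega>) = 0"
    and "n \<le> m"
  shows "expectation (\<lambda>\<omega>. (X m \<omega> - X n \<omega>)\<^sup>2) =
    expectation (\<lambda>\<omega>. (X m \<omega>)\<^sup>2) - expectation (\<lambda>\<omega>. (X n \<omega>)\<^sup>2)"
proof -
  have L2: "square_integrable M (X k)" for k
    by (rule square_integrable_bounded[OF meas bounded])
  have int: "integrable M (\<lambda>\<omega>. (X m \<omega> - X n \<omega>) * X n \<omega>)"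
    by (intro integrable_mult_square_integrable square_integrable_diff L2)
  have eq: "(X m \<omega> - X n \<omega>)\<^sup>2 = (X m \<omega>)\<^sup>2 - (X n \<omega>)\<^sup>2 - 2 * ((X m \<omega> - X n \<omega>) * X n \<omega>)" for \<omega>
    by (simp add: power2_eq_square algebra_simps)
  have "expectation (\<lambda>\<omega>. (X m \<omega> - X n \<omega>) * X n \<omega>) = 0"
    by (rule orth[OF \<open>n \<le> m\<close> adapted[OF order_refl] meas bounded])
  then show ?thesis
    unfolding eq using int square_integrable_power2[OF L2] by simp
qed

text \<open>Kolmogorov's inequality by first exit: on the event \<open>J j\<close> that the deviation first exceeds \<open>\<epsilon>\<close> at
time \<open>j + 1\<close>, the remaining increment up to time \<open>m\<close> is orthogonal to the deviation reached, so the
second moment of the final deviation on \<open>J j\<close> is at least \<open>\<epsilon>\<^sup>2\<close> times its probability.\<close>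

lemma (in prob_space) bounded_martingale_maximal_inequality:
  fixes X :: "nat \<Rightarrow> 'a \<Rightarrow> real"
  assumes meas [measurable]: "\<And>n. X n \<in> borel_measurable M"
    and adapted: "\<And>n k. k \<le> n \<Longrightarrow> X k \<in> borel_measurable (F n)"
    and bounded: "\<And>n \<omega>. \<omega> \<in> space M \<Longrightarrow> \<bar>X n \<omega>\<bar> \<le> B n"
    and orth: "\<And>n m Z c. n \<le> m \<Longrightarrow> Z \<in> borel_measurable (F n) \<Longrightarrow> Z \<in> borel_measurable M \<Longrightarrow>
      (\<And>\<omega>. \<omega> \<in> space M \<Longrightarrow> \<bar>Z \<omega>\<bar> \<le> c) \<Longrightarrow> expectation (\<lambda>\<omega>. (X m \<omega> - X n \<omega>) * Z \<omega>) = 0"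
    and "n \<le> m" "0 < \<epsilon>"
  shows "\<epsilon>\<^sup>2 * prob {\<omega> \<in> space M. \<exists>k\<in>{n..m}. \<epsilon> < \<bar>X k \<omega> - X n \<omega>\<bar>} \<le>
    expectation (\<lambda>\<omega>. (X m \<omega> - X n \<omega>)\<^sup>2)"
proof -
  define I where "I j \<omega> = (of_bool (\<exists>k\<in>{n..j}. \<epsilon> < \<bar>X k \<omega> - X n \<omega>\<bar>) :: real)" for j \<omega>
  define J where "J j \<omega> = (of_bool ((\<forall>k\<in>{n..j}. \<bar>X k \<omega> - X n \<omega>\<bar> \<le> \<epsilon>) \<and>
    \<epsilon> < \<bar>X (Suc j) \<omega> - X n \<omega>\<bar>) :: real)" for j \<omega>
  have L2: "square_integrable M (X k)" for k
    by (rule square_integrable_bounded[OF meas bounded])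
  have I_meas [measurable]: "I j \<in> borel_measurable M" for j
    unfolding I_def[abs_def] by measurable
  have J_meas [measurable]: "J j \<in> borel_measurable M" for j
    unfolding J_def[abs_def] by measurable
  have weighted: "integrable M (\<lambda>\<omega>. I j \<omega> * (X a \<omega> - X b \<omega>)\<^sup>2)"
    "integrable M (\<lambda>\<omega>. J j \<omega> * (X a \<omega> - X b \<omega>)\<^sup>2)"
    "integrable M (\<lambda>\<omega>. (X a \<omega> - X b \<omega>) * (J j \<omega> * (X c \<omega> - X d \<omega>)))" for j a b c d
  proof -
    have sq: "square_integrable M (\<lambda>\<omega>. X a \<omega> - X b \<omega>)" for a b
      by (intro square_integrable_diff L2)
    have I: "square_integrable M (\<lambda>\<omega>. I j \<omega> * (X a \<omega> - X b \<omega>))" for a b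
      by (rule square_integrable_mult_bounded[OF sq I_meas, where c = 1]) (simp add: I_def)
    have J: "square_integrable M (\<lambda>\<omega>. J j \<omega> * (X a \<omega> - X b \<omega>))" for a b
      by (rule square_integrable_mult_bounded[OF sq J_meas, where c = 1]) (simp add: J_def)
    show "integrable M (\<lambda>\<omega>. I j \<omega> * (X a \<omega> - X b \<omega>)\<^sup>2)"
      "integrable M (\<lambda>\<omega>. J j \<omega> * (X a \<omega> - X b \<omega>)\<^sup>2)"
      "integrable M (\<lambda>\<omega>. (X a \<omega> - X b \<omega>) * (J j \<omega> * (X c \<omega> - X d \<omega>)))"
      using integrable_mult_square_integrable[OF I sq] integrable_mult_square_integrable[OF J sq]
        integrable_mult_square_integrable[OF sq J]
      by (simp_all add: power2_eq_square mult.assoc)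
  qed
  have int01: "integrable M (I j)" "integrable M (J j)" for j
    by (rule integrable_const_bound[where B = 1]; simp add: I_def J_def)+
  have "\<epsilon>\<^sup>2 * expectation (I j) \<le> expectation (\<lambda>\<omega>. I j \<omega> * (X m \<omega> - X n \<omega>)\<^sup>2)"
    if "n \<le> j" "j \<le> m" for j
    using that
  proof (induction j rule: dec_induct)
    case base
    have "I n \<omega> = 0" for \<omega> using \<open>0 < \<epsilon>\<close> by (simp add: I_def)
    then show ?case by simp
  next
    case (step j)
    have split: "I (Suc j) \<omega> = I j \<omega> + J j \<omega>" for \<omega>
      using step.hyps by (fastforce simp: I_def J_def atLeastAtMostSuc_conv of_bool_def not_less)
    let ?Z = "\<lambda>\<omega>. J j \<omega> * (X (Suc j) \<omega> - X n \<omega>)"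
    \<comment> \<open>Cutting the index off at \<open>Suc j\<close> makes every \<open>G k\<close> measurable at time \<open>Suc j\<close> without side
      condition.\<close>
    define G where "G k \<omega> = X (min k (Suc j)) \<omega> - X n \<omega>" for k \<omega>
    have [measurable]: "G k \<in> borel_measurable (F (Suc j))" for k
      unfolding G_def[abs_def] using step.hyps by (intro borel_measurable_diff adapted) auto
    have J_G: "J j \<omega> = of_bool ((\<forall>k\<in>{n..j}. \<bar>G k \<omega>\<bar> \<le> \<epsilon>) \<and> \<epsilon> < \<bar>G (Suc j) \<omega>\<bar>)" for \<omega>
      by (auto simp: J_def G_def min_def)
    have "?Z = (\<lambda>\<omega>. of_bool ((\<forall>k\<in>{n..j}. \<bar>G k \<omega>\<bar> \<le> \<epsilon>) \<and> \<epsilon> < \<bar>G (Suc j) \<omega>\<bar>) * G (Suc j) \<omega>)"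
      unfolding J_G by (simp add: G_def)
    also have "\<dots> \<in> borel_measurable (F (Suc j))" by measurable
    finally have ZF: "?Z \<in> borel_measurable (F (Suc j))" .
    have Zb: "\<bar>?Z \<omega>\<bar> \<le> B (Suc j) + B n" if "\<omega> \<in> space M" for \<omega>
      using bounded[OF that, of "Suc j"] bounded[OF that, of n] by (auto simp: J_def)
    \<comment> \<open>The martingale property at the exit time.\<close>
    have zero: "expectation (\<lambda>\<omega>. (X m \<omega> - X (Suc j) \<omega>) * ?Z \<omega>) = 0"
      by (rule orth[OF _ ZF _ Zb]) (use step.prems in auto)
    have eq: "J j \<omega> * (X m \<omega> - X n \<omega>)\<^sup>2 = J j \<omega> * (X m \<omega> - X (Suc j) \<omega>)\<^sup>2
        + 2 * ((X m \<omega> - X (Suc j) \<omega>) * ?Z \<omega>) + J j \<omega> * (X (Suc j) \<omega> - X n \<omega>)\<^sup>2" for \<omega>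
      by (simp add: power2_eq_square algebra_simps)
    have "\<epsilon>\<^sup>2 * expectation (J j) = expectation (\<lambda>\<omega>. \<epsilon>\<^sup>2 * J j \<omega>)" by simp
    also have "\<dots> \<le> expectation (\<lambda>\<omega>. J j \<omega> * (X (Suc j) \<omega> - X n \<omega>)\<^sup>2)"
    proof (rule integral_mono)
      fix \<omega>
      have "\<epsilon>\<^sup>2 \<le> (X (Suc j) \<omega> - X n \<omega>)\<^sup>2" if "\<epsilon> < \<bar>X (Suc j) \<omega> - X n \<omega>\<bar>"
        using that \<open>0 < \<epsilon>\<close> by (intro abs_le_square_iff[THEN iffD1]) simp
      then show "\<epsilon>\<^sup>2 * J j \<omega> \<le> J j \<omega> * (X (Suc j) \<omega> - X n \<omega>)\<^sup>2"
        by (simp add: J_def)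
    qed (use int01 weighted in auto)
    also have "\<dots> \<le> expectation (\<lambda>\<omega>. J j \<omega> * (X m \<omega> - X n \<omega>)\<^sup>2)"
      unfolding eq using weighted zero
      by (simp add: integral_nonneg_AE J_def)
    finally have "\<epsilon>\<^sup>2 * expectation (J j) \<le> expectation (\<lambda>\<omega>. J j \<omega> * (X m \<omega> - X n \<omega>)\<^sup>2)" .
    then show ?case
      using step.IH step.prems int01 weighted by (simp add: split distrib_left distrib_right)
  qed
  from this[OF \<open>n \<le> m\<close> order_refl]
  have "\<epsilon>\<^sup>2 * expectation (I m) \<le> expectation (\<lambda>\<omega>. I m \<omega> * (X m \<omega> - X n \<omega>)\<^sup>2)" .
  also have "\<dots> \<le> expectation (\<lambda>\<omega>. (X m \<omega> - X n \<omega>)\<^sup>2)"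
    by (intro integral_mono weighted square_integrable_power2 square_integrable_diff L2)
       (auto simp: I_def)
  also have "expectation (I m) = prob {\<omega> \<in> space M. \<exists>k\<in>{n..m}. \<epsilon> < \<bar>X k \<omega> - X n \<omega>\<bar>}"
  proof -
    have "expectation (I m) = expectation (indicator {\<omega> \<in> space M. \<exists>k\<in>{n..m}. \<epsilon> < \<bar>X k \<omega> - X n \<omega>\<bar>})"
      by (intro Bochner_Integration.integral_cong) (auto simp: I_def indicator_def)
    then show ?thesis by simp
  qed
  finally show ?thesis .
qed

text \<open>The second moments increase to a finite limit, so the increments after time \<open>n\<close> are uniformly small
in \<open>L\<^sup>2\<close>. The maximal inequality makes the oscillation after time \<open>n\<close> small in probability, and
therefore almost every path is Cauchy.\<close>

theorem (in prob_space) bounded_martingale_convergence: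
  fixes X :: "nat \<Rightarrow> 'a \<Rightarrow> real"
  assumes meas [measurable]: "\<And>n. X n \<in> borel_measurable M"
    and adapted: "\<And>n k. k \<le> n \<Longrightarrow> X k \<in> borel_measurable (F n)"
    and bounded: "\<And>n \<omega>. \<omega> \<in> space M \<Longrightarrow> \<bar>X n \<omega>\<bar> \<le> B n"
    and orth: "\<And>n m Z c. n \<le> m \<Longrightarrow> Z \<in> borel_measurable (F n) \<Longrightarrow> Z \<in> borel_measurable M \<Longrightarrow>
      (\<And>\<omega>. \<omega> \<in> space M \<Longrightarrow> \<bar>Z \<omega>\<bar> \<le> c) \<Longrightarrow> expectation (\<lambda>\<omega>. (X m \<omega> - X n \<omega>) * Z \<omega>) = 0"
    and L2_bounded: "\<And>n. expectation (\<lambda>\<omega>. (X n \<omega>)\<^sup>2) \<le> C"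
  shows "AE \<omega> in M. convergent (\<lambda>n. X n \<omega>)"
proof -
  define v where "v n = expectation (\<lambda>\<omega>. (X n \<omega>)\<^sup>2)" for n
  have diff: "expectation (\<lambda>\<omega>. (X m \<omega> - X n \<omega>)\<^sup>2) = v m - v n" if "n \<le> m" for n m
    unfolding v_def by (rule bounded_martingale_orthogonal[OF meas adapted bounded orth that])
  have "incseq v"
  proof (rule incseq_SucI)
    fix n show "v n \<le> v (Suc n)"
      using diff[of n "Suc n"] integral_nonneg_AE[of "\<lambda>\<omega>. (X (Suc n) \<omega> - X n \<omega>)\<^sup>2" M] by simp
  qed
  moreover have "\<forall>n. v n \<le> C" using L2_bounded by (simp add: v_def)
  ultimately obtain V where V: "v \<longlonglongrightarrow> V" "\<forall>n. v n \<le> V"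
    using incseq_convergent by blast
  have tail: "AE \<omega> in M. \<exists>n. \<forall>k\<ge>n. \<bar>X k \<omega> - X n \<omega>\<bar> \<le> \<epsilon>" if "0 < \<epsilon>" for \<epsilon>
  proof -
    define A where "A n m = {\<omega> \<in> space M. \<exists>k\<in>{n..m}. \<epsilon> < \<bar>X k \<omega> - X n \<omega>\<bar>}" for n m
    have A [measurable]: "A n m \<in> sets M" for n m
      unfolding A_def by measurable
    have bound: "prob (\<Union>m. A n m) \<le> (V - v n) / \<epsilon>\<^sup>2" for n
    proof (rule LIMSEQ_le_const2)
      have "incseq (A n)" unfolding A_def by (fastforce simp: incseq_def)
      then show "(\<lambda>m. prob (A n m)) \<longlonglongrightarrow> prob (\<Union>m. A n m)"
        by (intro finite_Lim_measure_incseq) auto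
      have "prob (A n m) \<le> (V - v n) / \<epsilon>\<^sup>2" if "n \<le> m" for m
      proof -
        have "\<epsilon>\<^sup>2 * prob (A n m) \<le> v m - v n"
          unfolding A_def diff[OF that, symmetric]
          by (rule bounded_martingale_maximal_inequality[OF meas adapted bounded orth that \<open>0 < \<epsilon>\<close>])
        also have "\<dots> \<le> V - v n" using V(2) by simp
        finally show ?thesis using \<open>0 < \<epsilon>\<close> by (simp add: field_simps)
      qed
      then show "\<exists>N. \<forall>m\<ge>N. prob (A n m) \<le> (V - v n) / \<epsilon>\<^sup>2" by blast
    qed
    have "prob (\<Inter>n. \<Union>m. A n m) \<le> 0"
    proof (rule LIMSEQ_le_const)
      have "(\<lambda>n. (V - v n) / \<epsilon>\<^sup>2) \<longlonglongrightarrow> (V - V) / \<epsilon>\<^sup>2"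
        by (intro tendsto_intros V) (use \<open>0 < \<epsilon>\<close> in auto)
      then show "(\<lambda>n. (V - v n) / \<epsilon>\<^sup>2) \<longlonglongrightarrow> 0" by simp
      have "prob (\<Inter>n. \<Union>m. A n m) \<le> prob (\<Union>m. A n m)" for n
        by (rule finite_measure_mono) auto
      then show "\<exists>N. \<forall>n\<ge>N. prob (\<Inter>n. \<Union>m. A n m) \<le> (V - v n) / \<epsilon>\<^sup>2"
        using bound order_trans by blast
    qed
    then have "prob (\<Inter>n. \<Union>m. A n m) = 0"
      using measure_nonneg[of M "\<Inter>n. \<Union>m. A n m"] by linarith
    then have "(\<Inter>n. \<Union>m. A n m) \<in> null_sets M"
      by (auto simp: null_sets_def emeasure_eq_measure)
    then have "AE \<omega> in M. \<omega> \<notin> (\<Inter>n. \<Union>m. A n m)" by (rule AE_not_in)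
    then show ?thesis
    proof (rule AE_mp, intro AE_I2 impI)
      fix \<omega> assume "\<omega> \<in> space M" "\<omega> \<notin> (\<Inter>n. \<Union>m. A n m)"
      then obtain n where "\<And>m. \<omega> \<notin> A n m" by auto
      then have "\<forall>k\<ge>n. \<bar>X k \<omega> - X n \<omega>\<bar> \<le> \<epsilon>"
        using \<open>\<omega> \<in> space M\<close> unfolding A_def by (fastforce simp: not_less)
      then show "\<exists>n. \<forall>k\<ge>n. \<bar>X k \<omega> - X n \<omega>\<bar> \<le> \<epsilon>" by blast
    qed
  qed
  have "AE \<omega> in M. \<forall>j. \<exists>n. \<forall>k\<ge>n. \<bar>X k \<omega> - X n \<omega>\<bar> \<le> inverse (real (Suc j))"
    unfolding AE_all_countable by (intro allI tail) simp
  then show ?thesis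
  proof (rule AE_mp, intro AE_I2 impI)
    fix \<omega> assume *: "\<forall>j. \<exists>n. \<forall>k\<ge>n. \<bar>X k \<omega> - X n \<omega>\<bar> \<le> inverse (real (Suc j))"
    have "Cauchy (\<lambda>n. X n \<omega>)"
    proof (rule CauchyI)
      fix e :: real assume "0 < e"
      then obtain j where "inverse (real (Suc j)) < e / 2"
        using reals_Archimedean[of "e / 2"] by auto
      moreover obtain n where n: "\<And>k. k \<ge> n \<Longrightarrow> \<bar>X k \<omega> - X n \<omega>\<bar> \<le> inverse (real (Suc j))"
        using * by blast
      ultimately have "\<bar>X k \<omega> - X l \<omega>\<bar> < e" if "k \<ge> n" "l \<ge> n" for k l
        using n[OF that(1)] n[OF that(2)] by linarith
      then show "\<exists>n. \<forall>k\<ge>n. \<forall>l\<ge>n. norm (X k \<omega> - X l \<omega>) < e"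
        by (intro exI[of _ n]) auto
    qed
    then show "convergent (\<lambda>n. X n \<omega>)"
      by (simp add: Cauchy_convergent_iff)
  qed
qed

text \<open>Fatou's lemma, applied for fixed \<open>n\<close> along \<open>m\<close>, turns the Cauchy estimate into an \<open>L\<^sup>2\<close> estimate of the
distance to the almost sure limit; \<open>L\<^sup>2\<close> convergence carries first and second moments along.\<close>

lemma (in prob_space) square_integrable_limit:
  fixes X :: "nat \<Rightarrow> 'a \<Rightarrow> real"
  assumes L2: "\<And>n. square_integrable M (X n)" and Y [measurable]: "Y \<in> borel_measurable M"
    and lim: "AE \<omega> in M. (\<lambda>n. X n \<omega>) \<longlonglongrightarrow> Y \<omega>"
    and cauchy: "\<And>n m. n \<le> m \<Longrightarrow> expectation (\<lambda>\<omega>. (X m \<omega> - X n \<omega>)\<^sup>2) \<le> \<delta> n"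
    and \<delta>: "\<delta> \<longlonglongrightarrow> 0"
  shows "square_integrable M Y"
    and "(\<lambda>n. expectation (X n)) \<longlonglongrightarrow> expectation Y"
    and "(\<lambda>n. expectation (\<lambda>\<omega>. (X n \<omega>)\<^sup>2)) \<longlonglongrightarrow> expectation (\<lambda>\<omega>. (Y \<omega>)\<^sup>2)"
proof -
  have [measurable]: "X n \<in> borel_measurable M" for n
    using L2 by (rule square_integrable_measurable)
  define R where "R n \<omega> = Y \<omega> - X n \<omega>" for n \<omega>
  have [measurable]: "R n \<in> borel_measurable M" for n
    unfolding R_def[abs_def] by measurable
  have \<delta>_nonneg: "0 \<le> \<delta> n" for n
    using cauchy[of n n] by simp
  have bound: "(\<integral>\<^sup>+\<omega>. ennreal ((R n \<omega>)\<^sup>2) \<partial>M) \<le> ennreal (\<delta> n)" for n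
  proof -
    have "(\<integral>\<^sup>+\<omega>. ennreal ((R n \<omega>)\<^sup>2) \<partial>M) =
        (\<integral>\<^sup>+\<omega>. liminf (\<lambda>m. ennreal ((X m \<omega> - X n \<omega>)\<^sup>2)) \<partial>M)"
    proof (rule nn_integral_cong_AE)
      show "AE \<omega> in M. ennreal ((R n \<omega>)\<^sup>2) = liminf (\<lambda>m. ennreal ((X m \<omega> - X n \<omega>)\<^sup>2))"
        using lim
      proof eventually_elim
        case (elim \<omega>)
        have "(\<lambda>m. ennreal ((X m \<omega> - X n \<omega>)\<^sup>2)) \<longlonglongrightarrow> ennreal ((R n \<omega>)\<^sup>2)"
          unfolding R_def by (intro tendsto_ennrealI tendsto_intros elim)
        then show ?case by (rule lim_imp_Liminf[OF sequentially_bot, symmetric])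
      qed
    qed
    also have "\<dots> \<le> liminf (\<lambda>m. \<integral>\<^sup>+\<omega>. ennreal ((X m \<omega> - X n \<omega>)\<^sup>2) \<partial>M)"
      by (rule nn_integral_liminf) measurable
    also have "\<dots> \<le> ennreal (\<delta> n)"
    proof -
      have "(\<integral>\<^sup>+\<omega>. ennreal ((X m \<omega> - X n \<omega>)\<^sup>2) \<partial>M) \<le> ennreal (\<delta> n)" if "n \<le> m" for m
        using cauchy[OF that] square_integrable_power2[OF square_integrable_diff[OF L2 L2], of m n]
        by (subst nn_integral_eq_integral) (auto intro: ennreal_leI)
      then have "\<forall>\<^sub>F m in sequentially. (\<integral>\<^sup>+\<omega>. ennreal ((X m \<omega> - X n \<omega>)\<^sup>2) \<partial>M) \<le> ennreal (\<delta> n)"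
        using eventually_sequentially by auto
      then have "liminf (\<lambda>m. \<integral>\<^sup>+\<omega>. ennreal ((X m \<omega> - X n \<omega>)\<^sup>2) \<partial>M) \<le> liminf (\<lambda>m. ennreal (\<delta> n))"
        by (rule Liminf_mono)
      then show ?thesis by (simp add: Liminf_const)
    qed
    finally show ?thesis .
  qed
  have R: "square_integrable M (R n)" for n
    unfolding square_integrable_def
  proof
    show "integrable M (\<lambda>\<omega>. (R n \<omega>)\<^sup>2)"
      using bound[of n] by (intro integrableI_bounded) (auto intro: le_less_trans)
  qed simp
  have R2: "expectation (\<lambda>\<omega>. (R n \<omega>)\<^sup>2) \<le> \<delta> n" for n
    using bound[of n] square_integrable_power2[OF R[of n]] \<delta>_nonneg
    by (subst (asm) nn_integral_eq_integral) auto
  have "Y = (\<lambda>\<omega>. R 0 \<omega> + X 0 \<omega>)" by (auto simp: R_def)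
  then show Y2: "square_integrable M Y"
    using square_integrable_add[OF R L2, of 0 0] by simp
  have weak: "(\<lambda>n. expectation (\<lambda>\<omega>. Z \<omega> * R n \<omega>)) \<longlonglongrightarrow> 0" if Z: "square_integrable M Z" for Z
  proof (rule Lim_null_comparison)
    \<comment> \<open>Young's inequality needs a positive weight of order \<open>sqrt (\<delta> n)\<close>, also where \<open>\<delta> n = 0\<close>.\<close>
    define c where "c n = sqrt (\<delta> n) + inverse (real (Suc n))" for n
    have c_pos: "0 < c n" for n
      unfolding c_def by (intro add_nonneg_pos) (use \<delta>_nonneg in auto)
    have c_lim: "c \<longlonglongrightarrow> 0"
      unfolding c_def using tendsto_add[OF tendsto_real_sqrt[OF \<delta>] LIMSEQ_inverse_real_of_nat] by simp
    have le: "\<bar>expectation (\<lambda>\<omega>. Z \<omega> * R n \<omega>)\<bar> \<le> c n * expectation (\<lambda>\<omega>. (Z \<omega>)\<^sup>2) + c n" for n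
    proof -
      have young: "\<bar>a * b\<bar> \<le> c n * a\<^sup>2 + b\<^sup>2 / c n" for a b
      proof -
        have "2 * (sqrt (c n) * \<bar>a\<bar>) * (\<bar>b\<bar> / sqrt (c n)) \<le> (sqrt (c n) * \<bar>a\<bar>)\<^sup>2 + (\<bar>b\<bar> / sqrt (c n))\<^sup>2"
          by (rule sum_squares_bound)
        then have "2 * \<bar>a * b\<bar> \<le> c n * a\<^sup>2 + b\<^sup>2 / c n"
          using c_pos[of n] by (simp add: power_mult_distrib power_divide abs_mult)
        moreover have "0 \<le> \<bar>a * b\<bar>" by simp
        ultimately show ?thesis by linarith
      qed
      have "\<bar>expectation (\<lambda>\<omega>. Z \<omega> * R n \<omega>)\<bar> \<le> expectation (\<lambda>\<omega>. \<bar>Z \<omega> * R n \<omega>\<bar>)"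
        by (rule integral_abs_bound)
      also have "\<dots> \<le> expectation (\<lambda>\<omega>. c n * (Z \<omega>)\<^sup>2 + (R n \<omega>)\<^sup>2 / c n)"
        using young square_integrable_power2[OF Z] square_integrable_power2[OF R]
        by (intro integral_mono integrable_abs integrable_mult_square_integrable[OF Z R]) auto
      also have "\<dots> = c n * expectation (\<lambda>\<omega>. (Z \<omega>)\<^sup>2) + expectation (\<lambda>\<omega>. (R n \<omega>)\<^sup>2) / c n"
        using square_integrable_power2[OF Z] square_integrable_power2[OF R] by simp
      also have "expectation (\<lambda>\<omega>. (R n \<omega>)\<^sup>2) / c n \<le> c n"
      proof -
        have "\<delta> n = (sqrt (\<delta> n))\<^sup>2" using \<delta>_nonneg by simp
        also have "\<dots> \<le> (c n)\<^sup>2" unfolding c_def by (intro power_mono) (use \<delta>_nonneg in auto)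
        finally show ?thesis
          using R2[of n] c_pos[of n] by (simp add: divide_le_eq power2_eq_square)
      qed
      finally show ?thesis by simp
    qed
    show "\<forall>\<^sub>F n in sequentially. norm (expectation (\<lambda>\<omega>. Z \<omega> * R n \<omega>)) \<le>
        c n * expectation (\<lambda>\<omega>. (Z \<omega>)\<^sup>2) + c n"
      using le by simp
    show "(\<lambda>n. c n * expectation (\<lambda>\<omega>. (Z \<omega>)\<^sup>2) + c n) \<longlonglongrightarrow> 0"
      using tendsto_add[OF tendsto_mult_right[OF c_lim] c_lim] by simp
  qed
  have "expectation (X n) = expectation Y - expectation (\<lambda>\<omega>. 1 * R n \<omega>)" for n
    using integrable_square_integrable[OF R, of n] integrable_square_integrable[OF Y2]
      integrable_square_integrable[OF L2, of n] by (simp add: R_def)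
  moreover have "(\<lambda>n. expectation Y - expectation (\<lambda>\<omega>. 1 * R n \<omega>)) \<longlonglongrightarrow> expectation Y - 0"
    by (intro tendsto_intros weak square_integrable_const)
  ultimately show "(\<lambda>n. expectation (X n)) \<longlonglongrightarrow> expectation Y" by simp
  have R2_lim: "(\<lambda>n. expectation (\<lambda>\<omega>. (R n \<omega>)\<^sup>2)) \<longlonglongrightarrow> 0"
    by (rule Lim_null_comparison[OF _ \<delta>]) (use R2 in auto)
  have "(X n \<omega>)\<^sup>2 = (Y \<omega>)\<^sup>2 - 2 * (Y \<omega> * R n \<omega>) + (R n \<omega>)\<^sup>2" for n \<omega>
    by (simp add: R_def power2_eq_square algebra_simps)
  then have "expectation (\<lambda>\<omega>. (X n \<omega>)\<^sup>2) = expectation (\<lambda>\<omega>. (Y \<omega>)\<^sup>2)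
      - 2 * expectation (\<lambda>\<omega>. Y \<omega> * R n \<omega>) + expectation (\<lambda>\<omega>. (R n \<omega>)\<^sup>2)" for n
    using integrable_mult_square_integrable[OF Y2 R] square_integrable_power2[OF Y2]
      square_integrable_power2[OF R] by simp
  moreover have "(\<lambda>n. expectation (\<lambda>\<omega>. (Y \<omega>)\<^sup>2) - 2 * expectation (\<lambda>\<omega>. Y \<omega> * R n \<omega>)
      + expectation (\<lambda>\<omega>. (R n \<omega>)\<^sup>2)) \<longlonglongrightarrow> expectation (\<lambda>\<omega>. (Y \<omega>)\<^sup>2) - 2 * 0 + 0"
    by (intro tendsto_intros weak Y2 R2_lim)
  ultimately show "(\<lambda>n. expectation (\<lambda>\<omega>. (X n \<omega>)\<^sup>2)) \<longlonglongrightarrow> expectation (\<lambda>\<omega>. (Y \<omega>)\<^sup>2)" by simp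
qed

section \<open>Mean absolute displacement of the symmetric binomial law\<close>

text \<open>\<open>mean_abs k x\<close> is the mean of \<open>\<bar>x - S\<bar>\<close> for \<open>S\<close> binomial with parameters \<open>k\<close> and \<open>1 / 2\<close>,
unfolded over the last trial.\<close>

primrec mean_abs :: "nat \<Rightarrow> int \<Rightarrow> real" where
  "mean_abs 0 x = \<bar>of_int x\<bar>"
| "mean_abs (Suc k) x = (mean_abs k x + mean_abs k (x - 1)) / 2"

lemma mean_abs_lipschitz: "\<bar>mean_abs k x - mean_abs k y\<bar> \<le> \<bar>of_int x - of_int y\<bar>"
proof (induction k arbitrary: x y)
  case (Suc k)
  show ?case
    using Suc[of x y] Suc[of "x - 1" "y - 1"] by (simp add: abs_le_iff field_simps)
qed simp

lemma mean_abs_Suc_diff: "\<bar>mean_abs (Suc k) x - mean_abs k x\<bar> \<le> 1"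
  using mean_abs_lipschitz[of k x "x - 1"] by (simp add: abs_if split: if_splits)

text \<open>The second difference of \<open>\<bar>x\<bar>\<close> is twice a point mass at \<open>0\<close>, and averaging over the trials turns it
into twice the binomial weight of \<open>j\<close>. The closed form for \<open>mean_abs\<close> on the diagonal follows by
summing these weights.\<close>

lemma mean_abs_second_difference:
  "mean_abs k (int j + 1) - 2 * mean_abs k (int j) + mean_abs k (int j - 1) = 2 * real (k choose j) / 2 ^ k"
proof (induction k arbitrary: j)
  case 0
  show ?case by (cases j) auto
next
  case (Suc k)
  show ?case
  proof (cases j)
    case 0
    have neg: "mean_abs k (- 1 + 1) - 2 * mean_abs k (- 1) + mean_abs k (- 1 - 1) = 0" for k
    proof -
      have lin: "mean_abs k x = real k / 2 - of_int x" if "x \<le> 0" for x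
        using that
      proof (induction k arbitrary: x)
        case (Suc k)
        show ?case
          using Suc.IH[of x] Suc.IH[of "x - 1"] Suc.prems by (simp add: field_simps)
      qed simp
      show ?thesis by (simp add: lin)
    qed
    have "mean_abs (Suc k) (int j + 1) - 2 * mean_abs (Suc k) (int j) + mean_abs (Suc k) (int j - 1) =
        ((mean_abs k (int 0 + 1) - 2 * mean_abs k (int 0) + mean_abs k (int 0 - 1))
        + (mean_abs k (- 1 + 1) - 2 * mean_abs k (- 1) + mean_abs k (- 1 - 1))) / 2"
      using 0 by (simp add: field_simps)
    then show ?thesis
      unfolding Suc neg using 0 by simp
  next
    case (Suc i)
    show ?thesis
      unfolding Suc mean_abs.simps binomial_Suc_Suc
      using Suc.IH[of i] Suc.IH[of "Suc i"] by (simp add: field_simps)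
  qed
qed

text \<open>Both this and the next lemma are the ratio of consecutive central binomial coefficients, without and
with the normalisation by \<open>4 ^ k\<close>.\<close>

lemma central_binomial_Suc:
  "real (Suc k) * real (2 * Suc k choose Suc k) = 2 * (2 * real k + 1) * real (2 * k choose k)"
proof -
  have "Suc k * (2 * Suc k choose Suc k) = (2 * Suc k) * (Suc (2 * k) choose k)"
    using Suc_times_binomial_eq[of "Suc (2 * k)" k] by (simp add: mult.commute)
  moreover have "Suc k * (Suc (2 * k) choose k) = Suc (2 * k) * (2 * k choose k)"
    using binomial_absorb_comp[of "Suc (2 * k)" k] by simp
  ultimately have "Suc k * (Suc k * (2 * Suc k choose Suc k)) =
      Suc k * (2 * (Suc (2 * k) * (2 * k choose k)))"
    by (metis (no_types, lifting) mult.assoc mult.left_commute)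
  then have "Suc k * (2 * Suc k choose Suc k) = 2 * (Suc (2 * k) * (2 * k choose k))"
    by (metis Suc_not_Zero mult_cancel1)
  then have "real (Suc k * (2 * Suc k choose Suc k)) = real (2 * (Suc (2 * k) * (2 * k choose k)))"
    by (rule arg_cong)
  then show ?thesis by (simp only: of_nat_mult) (simp add: algebra_simps)
qed

lemma central_binomial_density_Suc:
  "real (2 * Suc k choose Suc k) / 4 ^ Suc k =
    real (2 * k choose k) / 4 ^ k * (2 * real k + 1) / (2 * real k + 2)"
proof -
  have aux: "X / 4 ^ Suc k = Y / 4 ^ k * (2 * real k + 1) / (2 * real k + 2)"
    if "real (Suc k) * X = 2 * (2 * real k + 1) * Y" for X Y
  proof -
    have X: "X = 2 * (2 * real k + 1) * Y / real (Suc k)"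
      using that by (simp add: field_simps del: of_nat_Suc)
    show ?thesis unfolding X by (simp add: divide_simps) (simp add: algebra_simps)
  qed
  show ?thesis by (rule aux[OF central_binomial_Suc])
qed

lemma mean_abs_even: "mean_abs (2 * k) (int k) = real k * (real (2 * k choose k) / 4 ^ k)"
proof (induction k)
  case (Suc k)
  let ?c = "real (2 * k choose k) / 4 ^ k"
  have "mean_abs (2 * Suc k) (int (Suc k)) =
      mean_abs (2 * k) (int k) + (mean_abs (2 * k) (int k + 1) - 2 * mean_abs (2 * k) (int k)
        + mean_abs (2 * k) (int k - 1)) / 4"
    by (simp add: field_simps)
  also have "\<dots> = (real k + 1 / 2) * ?c"
    unfolding mean_abs_second_difference power_mult unfolding Suc by (simp add: field_simps)
  also have "\<dots> = real (Suc k) * (?c * (2 * real k + 1) / (2 * real k + 2))"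
    by (simp add: divide_simps) (simp add: algebra_simps)
  finally show ?case unfolding central_binomial_density_Suc .
qed simp

text \<open>The partial Wallis product times \<open>2 n + 1\<close> is the inverse square of the normalised central binomial
coefficient.\<close>

lemma central_binomial_asymptotics:
  "(\<lambda>n. sqrt (real n) * (real (2 * n choose n) / 4 ^ n)) \<longlonglongrightarrow> 1 / sqrt pi"
proof -
  define W where "W n = (\<Prod>k=1..n. (4 * real k ^ 2) / (4 * real k ^ 2 - 1))" for n
  define c where "c n = real (2 * n choose n) / 4 ^ n" for n
  have c_Suc: "c (Suc n) = c n * (2 * real n + 1) / (2 * real n + 2)" for n
    unfolding c_def by (rule central_binomial_density_Suc)
  have W_Suc: "W (Suc n) = W n * (4 * (real n + 1)\<^sup>2 / ((2 * real n + 1) * (2 * real n + 3)))" for n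
    by (simp add: W_def power2_eq_square algebra_simps)
  have prod: "W n * (2 * real n + 1) * (c n)\<^sup>2 = 1" for n
  proof (induction n)
    case 0
    show ?case by (simp add: W_def c_def)
  next
    case (Suc n)
    have "W (Suc n) * (2 * real (Suc n) + 1) * (c (Suc n))\<^sup>2 = W n * (2 * real n + 1) * (c n)\<^sup>2"
      unfolding W_Suc c_Suc by (simp add: power2_eq_square divide_simps) (simp add: algebra_simps)
    then show ?case using Suc by simp
  qed
  have W_lim: "W \<longlonglongrightarrow> pi / 2"
    unfolding W_def using wallis .
  have W_ne: "W n \<noteq> 0" for n
    using prod[of n] by auto
  have eq: "sqrt (real n) * c n = sqrt (real n / (2 * real n + 1) / W n)" for n
  proof -
    have "(c n)\<^sup>2 = 1 / (W n * (2 * real n + 1))"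
      using prod[of n] W_ne[of n] by (simp add: eq_divide_eq mult.commute)
    then have "real n / (2 * real n + 1) / W n = real n * (c n)\<^sup>2"
      by simp
    then show ?thesis by (simp add: real_sqrt_mult c_def)
  qed
  have "(\<lambda>n. real n / (2 * real n + 1)) \<longlonglongrightarrow> 1 / 2" by real_asymp
  then have "(\<lambda>n. sqrt (real n / (2 * real n + 1) / W n)) \<longlonglongrightarrow> sqrt (1 / 2 / (pi / 2))"
    by (intro tendsto_real_sqrt tendsto_divide[OF _ W_lim]) auto
  then show ?thesis
    unfolding eq[symmetric] c_def by (simp add: real_sqrt_divide)
qed

text \<open>\<open>mean_abs\<close> is Lipschitz in both arguments, so at bounded distance from the diagonal it may be replaced
by its explicit value on the diagonal. The case \<open>\<tau> = 0\<close>, which occurs when the two times in the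
covariance agree, does not force \<open>k n\<close> to infinity and uses only that \<open>mean_abs\<close> on the diagonal is
at most of the order of a square root.\<close>

lemma mean_abs_asymptotics:
  fixes k :: "nat \<Rightarrow> nat" and x :: "nat \<Rightarrow> int"
  assumes k: "(\<lambda>n. real (k n) / real n) \<longlonglongrightarrow> \<tau>" and x: "\<And>n. \<bar>2 * of_int (x n) - real (k n)\<bar> \<le> C"
  shows "(\<lambda>n. mean_abs (k n) (x n) / sqrt (real n)) \<longlonglongrightarrow> sqrt (\<tau> / (2 * pi))"
proof -
  define j where "j n = k n div 2" for n
  define b where "b n = sqrt (real n) * (real (2 * n choose n) / 4 ^ n)" for n
  have b: "b \<longlonglongrightarrow> 1 / sqrt pi"
    unfolding b_def by (rule central_binomial_asymptotics)
  have "0 \<le> \<tau>" by (rule LIMSEQ_le_const[OF k]) auto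
  have k_j: "k n = 2 * j n \<or> k n = Suc (2 * j n)" for n
    unfolding j_def by presburger
  have near: "\<bar>mean_abs (k n) (x n) - mean_abs (2 * j n) (int (j n))\<bar> \<le> C + 2" for n
  proof -
    have "\<bar>mean_abs (k n) (x n) - mean_abs (2 * j n) (x n)\<bar> \<le> 1"
      using k_j[of n] mean_abs_Suc_diff[of "2 * j n" "x n"] by auto
    moreover have "\<bar>mean_abs (2 * j n) (x n) - mean_abs (2 * j n) (int (j n))\<bar> \<le> \<bar>of_int (x n) - real (j n)\<bar>"
      using mean_abs_lipschitz[of "2 * j n" "x n" "int (j n)"] by simp
    moreover have "\<bar>of_int (x n) - real (j n)\<bar> \<le> C + 1"
      using x[of n] k_j[of n] by auto
    ultimately show ?thesis by linarith
  qed
  have j: "(\<lambda>n. real (j n) / real n) \<longlonglongrightarrow> \<tau> / 2"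
  proof -
    have "(\<lambda>n. real (k n) / real n / 2 - real (j n) / real n) \<longlonglongrightarrow> 0"
    proof (rule Lim_null_comparison)
      have "\<bar>real (k n) / real n / 2 - real (j n) / real n\<bar> \<le> 1 / real n" for n
      proof (cases "n = 0")
        case False
        then have e: "real (k n) / real n / 2 - real (j n) / real n = (real (k n) - 2 * real (j n)) / (2 * real n)"
          by (simp add: field_simps)
        have "1 / (2 * real n) \<le> 1 / real n"
          using False by (simp add: field_simps)
        then show ?thesis
          unfolding e using k_j[of n] by auto
      qed simp
      then show "\<forall>\<^sub>F n in sequentially. norm (real (k n) / real n / 2 - real (j n) / real n) \<le> 1 / real n"
        by simp
      show "(\<lambda>n. 1 / real n) \<longlonglongrightarrow> 0" by real_asymp
    qed
    from tendsto_diff[OF tendsto_divide[OF k tendsto_const[of 2]] this] show ?thesis by simp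
  qed
  have main: "(\<lambda>n. sqrt (real (j n) / real n) * b (j n)) \<longlonglongrightarrow> sqrt (\<tau> / 2) * (1 / sqrt pi)"
  proof (cases "\<tau> = 0")
    case True
    have "Bseq b" using b by (intro convergent_imp_Bseq) (auto simp: convergent_def)
    then obtain K where K: "\<And>n. \<bar>b n\<bar> \<le> K" unfolding Bseq_def by auto
    have "(\<lambda>n. sqrt (real (j n) / real n) * b (j n)) \<longlonglongrightarrow> 0"
    proof (rule Lim_null_comparison)
      show "\<forall>\<^sub>F n in sequentially. norm (sqrt (real (j n) / real n) * b (j n)) \<le> sqrt (real (j n) / real n) * K"
        using K by (intro always_eventually allI) (simp add: abs_mult mult_left_mono)
      show "(\<lambda>n. sqrt (real (j n) / real n) * K) \<longlonglongrightarrow> 0"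
        using tendsto_mult[OF tendsto_real_sqrt[OF j] tendsto_const[of K]] True by simp
    qed
    then show ?thesis using True by simp
  next
    case False
    then have "0 < \<tau> / 2" using \<open>0 \<le> \<tau>\<close> by simp
    then have "filterlim (\<lambda>n. real (j n) / real n * real n) at_top sequentially"
      by (intro filterlim_tendsto_pos_mult_at_top[OF j] filterlim_real_sequentially)
    moreover have "\<forall>\<^sub>F n in sequentially. real (j n) / real n * real n = real (j n)"
      using eventually_gt_at_top[of 0] by eventually_elim simp
    ultimately have "filterlim (\<lambda>n. real (j n)) at_top sequentially"
      by (rule filterlim_mono_eventually[OF _ order_refl order_refl])
    then have "filterlim j sequentially sequentially"
      by (simp add: filterlim_sequentially_iff_filterlim_real)
    then have "(\<lambda>n. b (j n)) \<longlonglongrightarrow> 1 / sqrt pi"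
      using b by (rule filterlim_compose[rotated])
    then show ?thesis by (intro tendsto_mult tendsto_real_sqrt j)
  qed
  have even: "mean_abs (2 * j n) (int (j n)) / sqrt (real n) = sqrt (real (j n) / real n) * b (j n)" for n
  proof -
    have "sqrt (real (j n) / real n) * b (j n) =
        sqrt (real (j n)) * sqrt (real (j n)) * (real (2 * j n choose j n) / 4 ^ j n) / sqrt (real n)"
      unfolding b_def real_sqrt_divide
      by (simp only: mult.assoc times_divide_eq_left times_divide_eq_right divide_divide_eq_left mult.commute[of "sqrt (real n)"])
    then show ?thesis unfolding mean_abs_even by simp
  qed
  have "(\<lambda>n. (mean_abs (k n) (x n) - mean_abs (2 * j n) (int (j n))) / sqrt (real n)) \<longlonglongrightarrow> 0"
  proof (rule Lim_null_comparison)
    show "\<forall>\<^sub>F n in sequentially. norm ((mean_abs (k n) (x n) - mean_abs (2 * j n) (int (j n))) / sqrt (real n))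
        \<le> (C + 2) / sqrt (real n)"
      using near by (intro always_eventually allI) (simp add: divide_right_mono)
    show "(\<lambda>n. (C + 2) / sqrt (real n)) \<longlonglongrightarrow> 0" by real_asymp
  qed
  then have "(\<lambda>n. sqrt (real (j n) / real n) * b (j n) +
      (mean_abs (k n) (x n) - mean_abs (2 * j n) (int (j n))) / sqrt (real n))
      \<longlonglongrightarrow> sqrt (\<tau> / 2) * (1 / sqrt pi) + 0"
    by (intro tendsto_add main)
  moreover have "sqrt (real (j n) / real n) * b (j n) +
      (mean_abs (k n) (x n) - mean_abs (2 * j n) (int (j n))) / sqrt (real n) =
      mean_abs (k n) (x n) / sqrt (real n)" for n
    by (simp add: even[symmetric] diff_divide_distrib)
  ultimately show ?thesis by (simp add: real_sqrt_divide real_sqrt_mult)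
qed

section \<open>Transport of height profiles\<close>

text \<open>\<open>evolve \<omega> h s k\<close> is the height profile at time \<open>s + k\<close> that is \<open>h\<close> at time \<open>s\<close>. Its increment
\<open>h x - h (x - 1)\<close> is the mean number of particles at \<open>x\<close>, and a fraction \<open>\<omega> (x, s)\<close> of them leaves
\<open>x\<close> to the right in a step.\<close>

primrec evolve :: "env \<Rightarrow> (int \<Rightarrow> real) \<Rightarrow> int \<Rightarrow> nat \<Rightarrow> int \<Rightarrow> real" where
  evolve_0: "evolve \<omega> h s 0 x = h x"
| evolve_Suc: "evolve \<omega> h s (Suc k) x =
    (1 - \<omega> (x, s + int k)) * evolve \<omega> h s k x + \<omega> (x, s + int k) * evolve \<omega> h s k (x - 1)"

text \<open>A step only looks one site to the left, so the height at \<open>x\<close> after \<open>k\<close> steps depends on the window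
\<open>{x - k..x}\<close> of the initial profile.\<close>

lemma evolve_cong_local:
  assumes "\<And>y. x - int k \<le> y \<Longrightarrow> y \<le> x \<Longrightarrow> h y = h' y"
  shows "evolve \<omega> h s k x = evolve \<omega> h' s k x"
  using assms
proof (induction k arbitrary: x)
  case (Suc k)
  have "evolve \<omega> h s k x = evolve \<omega> h' s k x" "evolve \<omega> h s k (x - 1) = evolve \<omega> h' s k (x - 1)"
    using Suc.prems by (auto intro!: Suc.IH)
  then show ?case by simp
qed auto

lemma evolve_add_const: "evolve \<omega> (\<lambda>y. h y + c) s k x = evolve \<omega> h s k x + c"
  by (induction k arbitrary: x) (auto simp: algebra_simps)

lemma evolve_diff: "evolve \<omega> (\<lambda>y. h y - h' y) s k x = evolve \<omega> h s k x - evolve \<omega> h' s k x"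
proof (induction k arbitrary: x)
  case (Suc k)
  show ?case by (simp only: evolve_Suc Suc) (simp add: algebra_simps)
qed simp

lemma evolve_cmult: "evolve \<omega> (\<lambda>y. c * h y) s k x = c * evolve \<omega> h s k x"
  by (induction k arbitrary: x) (auto simp: algebra_simps)

lemma evolve_sum: "evolve \<omega> (\<lambda>y. \<Sum>i\<in>I. h i y) s k x = (\<Sum>i\<in>I. evolve \<omega> (h i) s k x)"
  by (induction k arbitrary: x) (auto simp: sum.distrib sum_distrib_left)

lemma evolve_add_time:
  "evolve \<omega> h s (j + k) x = evolve \<omega> (evolve \<omega> h s j) (s + int j) k x"
proof (induction k arbitrary: x)
  case (Suc k)
  have "s + int j + int k = s + int (j + k)" by simp
  then show ?case using Suc by (simp add: add.assoc)
qed simp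

lemma shift_apply: "shift a b \<omega> (y, t) = \<omega> (a + y, b + t)"
  by (simp add: shift_def)

lemma evolve_shift:
  "evolve (shift a b \<omega>) h s k x = evolve \<omega> (\<lambda>y. h (y - a)) (s + b) k (a + x)"
proof (induction k arbitrary: x)
  case (Suc k)
  have "b + (s + int k) = s + b + int k" "a + (x - 1) = a + x - 1" by auto
  then show ?case by (simp only: evolve_Suc Suc shift_apply)
qed simp

lemma measurable_evolve:
  assumes "\<And>y. h y \<in> borel_measurable (coord_algebra borel A)"
  shows "(\<lambda>\<omega>. evolve \<omega> (\<lambda>y. h y \<omega>) s k x) \<in>
    borel_measurable (coord_algebra borel (A \<union> {i. s \<le> snd i \<and> snd i < s + int k}))"
proof (induction k arbitrary: x)
  case 0
  show ?case
    by (rule measurable_coord_algebra_mono[of borel A]) (use assms in auto)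
next
  case (Suc k)
  let ?F = "coord_algebra borel (A \<union> {i. s \<le> snd i \<and> snd i < s + int (Suc k)})"
  have [measurable]: "(\<lambda>\<omega>. evolve \<omega> (\<lambda>y. h y \<omega>) s k x) \<in> borel_measurable ?F" for x
    by (rule measurable_coord_algebra_mono[OF _ _ Suc]) auto
  have [measurable]: "(\<lambda>\<omega>. \<omega> (x, s + int k)) \<in> borel_measurable ?F"
    by (rule measurable_coord_algebra_coordinate) auto
  show ?case by (simp del: of_nat_Suc)
qed

text \<open>Increasing profiles stay increasing: mean particle numbers stay nonnegative.\<close>

lemma evolve_mono:
  assumes "\<And>i. 0 \<le> \<omega> i" "\<And>i. \<omega> i \<le> 1" "\<And>y. h (y - 1) \<le> h y"
  shows "evolve \<omega> h s k (x - 1) \<le> evolve \<omega> h s k x"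
proof (induction k arbitrary: x)
  case (Suc k)
  let ?e = "evolve \<omega> h s k" and ?u = "\<lambda>x. \<omega> (x, s + int k)"
  have "(1 - ?u (x - 1)) * ?e (x - 1) + ?u (x - 1) * ?e (x - 1 - 1) \<le>
      (1 - ?u (x - 1)) * ?e (x - 1) + ?u (x - 1) * ?e (x - 1)"
    using Suc[of "x - 1"] assms by (intro add_left_mono mult_left_mono) auto
  also have "\<dots> = (1 - ?u x) * ?e (x - 1) + ?u x * ?e (x - 1)"
    by (simp add: algebra_simps)
  also have "\<dots> \<le> (1 - ?u x) * ?e x + ?u x * ?e (x - 1)"
    using Suc[of x] assms by (intro add_right_mono mult_left_mono) auto
  finally show ?case by simp
qed (use assms in simp)

lemma evolve_flat_bounds:
  assumes "\<And>i. 0 \<le> \<omega> i" "\<And>i. \<omega> i \<le> 1"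
  shows "of_int x - real k \<le> evolve \<omega> of_int s k x \<and> evolve \<omega> of_int s k x \<le> of_int x"
proof (induction k arbitrary: x)
  case (Suc k)
  let ?e = "evolve \<omega> of_int s k" and ?u = "\<omega> (x, s + int k)"
  have "evolve \<omega> of_int s (Suc k) x \<in> closed_segment (?e x) (?e (x - 1))"
    unfolding closed_segment_def using assms by (auto intro!: exI[of _ ?u])
  moreover have "\<dots> \<subseteq> {of_int x - real (Suc k)..of_int x}"
    using Suc[of x] Suc[of "x - 1"] by (auto simp: closed_segment_eq_real_ivl)
  ultimately show ?case by (auto simp del: evolve_Suc)
qed simp

lemma evolve_const: "evolve \<omega> (\<lambda>_. c) s k x = c"
  by (induction k arbitrary: x) (auto simp: algebra_simps)

section \<open>One step of a random height profile\<close>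

abbreviation past :: "int \<Rightarrow> env measure" where
  "past m \<equiv> coord_algebra borel {i. snd i < m}"

abbreviation future :: "int \<Rightarrow> env measure" where
  "future m \<equiv> coord_algebra borel {i. m \<le> snd i}"

text \<open>Speed \<open>1 / 2\<close> is what makes the recursion for variances a symmetric average.\<close>

locale fair_environment = iid_environment +
  assumes p_one_half: "p_one P = 1 / 2"
begin

lemma env_bounds:
  assumes "\<omega> \<in> space P"
  shows "0 \<le> \<omega> i" "\<omega> i \<le> 1"
proof -
  have "space P = PiE UNIV (\<lambda>_. {0..1})"
    using sets_eq_imp_space_eq[OF sets_env] by (simp add: space_PiM space_restrict_space)
  then show "0 \<le> \<omega> i" "\<omega> i \<le> 1"
    using assms by (cases i; auto simp: PiE_def Pi_def)+
qed

lemma measurable_env [measurable]: "(\<lambda>\<omega>. \<omega> i) \<in> borel_measurable P"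
  using indep_env by (simp add: indep_vars_def del: split_paired_All)

lemma measurable_coord_algebra_P:
  "X \<in> coord_algebra borel A \<rightarrow>\<^sub>M K \<Longrightarrow> X \<in> P \<rightarrow>\<^sub>M K"
  by (rule measurable_from_coord_algebra[of borel]) auto

lemma integrable_env_fun:
  fixes g :: "real \<Rightarrow> real"
  assumes "g \<in> borel_measurable borel" "\<And>u. 0 \<le> u \<Longrightarrow> u \<le> 1 \<Longrightarrow> \<bar>g u\<bar> \<le> c"
  shows "integrable P (\<lambda>\<omega>. g (\<omega> i))"
  by (rule integrable_const_bound[where B = c]) (use assms env_bounds in auto)

lemma expectation_env_fun:
  assumes [measurable]: "(g :: real \<Rightarrow> real) \<in> borel_measurable borel"
  shows "expectation (\<lambda>\<omega>. g (\<omega> i)) = expectation (\<lambda>\<omega>. g (\<omega> (0, 0)))"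
proof -
  have "expectation (\<lambda>\<omega>. g (\<omega> i)) = integral\<^sup>L (distr P borel (\<lambda>\<omega>. \<omega> i)) g" for i
    by (simp add: integral_distr)
  then show ?thesis
    using ident_env[of i] by simp
qed

text \<open>Centred jump probabilities; their variance is \<open>beta\<close>.\<close>

definition \<xi> :: "int \<times> int \<Rightarrow> env \<Rightarrow> real" where
  "\<xi> i \<omega> = \<omega> i - 1 / 2"

definition beta :: real where
  "beta = 1 / 4 - alpha P"

lemma measurable_\<xi>: "i \<in> A \<Longrightarrow> \<xi> i \<in> borel_measurable (coord_algebra borel A)"
  unfolding \<xi>_def [abs_def]
  by (intro borel_measurable_diff measurable_coord_algebra_coordinate) auto

lemma \<xi>_bound: "\<omega> \<in> space P \<Longrightarrow> \<bar>\<xi> i \<omega>\<bar> \<le> 1"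
  using env_bounds[of \<omega> i] by (auto simp: \<xi>_def)

lemma expectation_\<xi>: "expectation (\<xi> i) = 0"
proof -
  have "integrable P (\<lambda>\<omega>. \<omega> i)"
    by (rule integrable_env_fun[where g = "\<lambda>u. u" and c = 1]) auto
  moreover have "expectation (\<lambda>\<omega>. \<omega> i) = 1 / 2"
    using p_one_half expectation_env_fun[of "\<lambda>u. u" i] by (simp add: p_one_def)
  ultimately show ?thesis
    by (simp add: \<xi>_def [abs_def] prob_space)
qed

lemma expectation_\<xi>_power2: "expectation (\<lambda>\<omega>. (\<xi> i \<omega>)\<^sup>2) = beta"
proof -
  have "expectation (\<lambda>\<omega>. (\<xi> i \<omega>)\<^sup>2) = expectation (\<lambda>\<omega>. 1 / 4 - \<omega> i * (1 - \<omega> i))"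
    by (intro Bochner_Integration.integral_cong) (auto simp: \<xi>_def power2_eq_square field_simps)
  also have "\<dots> = 1 / 4 - expectation (\<lambda>\<omega>. \<omega> i * (1 - \<omega> i))"
    by (subst Bochner_Integration.integral_diff)
       (auto simp: prob_space intro!: integrable_env_fun[where g = "\<lambda>u. u * (1 - u)" and c = 1]
         simp: abs_mult mult_le_one)
  also have "\<dots> = beta"
    using expectation_env_fun[of "\<lambda>u. u * (1 - u)" i] by (simp add: beta_def alpha_def)
  finally show ?thesis .
qed

lemma beta_nonneg: "0 \<le> beta"
  using expectation_\<xi>_power2[of undefined] by (metis integral_nonneg_AE AE_I2 zero_le_power2)

text \<open>If \<open>\<omega> (1 - \<omega>)\<close> had mean zero, the environment would almost surely take only the values \<open>0\<close> and \<open>1\<close>.\<close>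

lemma alpha_pos: "0 < alpha P"
proof -
  have int: "integrable P (\<lambda>\<omega>. \<omega> (0, 0) * (1 - \<omega> (0, 0)))"
    by (rule integrable_env_fun[where g = "\<lambda>u. u * (1 - u)" and c = 1])
       (auto simp: abs_mult mult_le_one)
  have nonneg: "AE \<omega> in P. 0 \<le> \<omega> (0, 0) * (1 - \<omega> (0, 0))"
    using env_bounds by (intro AE_I2) auto
  have "alpha P \<noteq> 0"
  proof
    assume "alpha P = 0"
    then have "AE \<omega> in P. \<omega> (0, 0) * (1 - \<omega> (0, 0)) = 0"
      using integral_nonneg_eq_0_iff_AE[OF int nonneg] by (simp add: alpha_def)
    then have "AE \<omega> in P. \<not> (0 < \<omega> (0, 0) \<and> \<omega> (0, 0) < 1)"
      by eventually_elim auto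
    then have "prob {\<omega> \<in> space P. 0 < \<omega> (0, 0) \<and> \<omega> (0, 0) < 1} = 0"
      by (subst prob_eq_0) auto
    then show False using nondegenerate by simp
  qed
  moreover have "0 \<le> alpha P"
    unfolding alpha_def using nonneg by (rule integral_nonneg_AE)
  ultimately show ?thesis by simp
qed

lemma expectation_mult_indep:
  assumes "A \<inter> B = {}"
    and X: "X \<in> borel_measurable (coord_algebra borel A)" "integrable P X"
    and Y: "Y \<in> borel_measurable (coord_algebra borel B)" "integrable P Y"
  shows "integrable P (\<lambda>\<omega>. X \<omega> * Y \<omega> :: real)"
    and "expectation (\<lambda>\<omega>. X \<omega> * Y \<omega>) = expectation X * expectation Y"
proof -
  have "indep_var borel X borel Y"
    by (rule indep_var_coord_algebra[OF prob_space_axioms indep_env _ X(1) Y(1) assms(1)]) simp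
  then show "integrable P (\<lambda>\<omega>. X \<omega> * Y \<omega>)"
    "expectation (\<lambda>\<omega>. X \<omega> * Y \<omega>) = expectation X * expectation Y"
    using X Y by (auto intro: indep_var_integrable indep_var_lebesgue_integral)
qed

lemma integrable_\<xi>: "integrable P (\<xi> i)"
  by (rule integrable_const_bound[where B = 1])
     (use \<xi>_bound measurable_coord_algebra_P[OF measurable_\<xi>[of i UNIV]] in auto)

lemma integrable_\<xi>_power2: "integrable P (\<lambda>\<omega>. (\<xi> i \<omega>)\<^sup>2)"
proof (rule integrable_const_bound[where B = 1])
  show "AE \<omega> in P. norm ((\<xi> i \<omega>)\<^sup>2) \<le> 1"
    using \<xi>_bound by (intro AE_I2) (simp add: abs_square_le_1)
qed (use measurable_coord_algebra_P[OF measurable_\<xi>[of i UNIV]] in auto)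

lemma expectation_\<xi>_mult_\<xi>:
  assumes "i \<noteq> j"
  shows "expectation (\<lambda>\<omega>. \<xi> i \<omega> * \<xi> j \<omega>) = 0" "integrable P (\<lambda>\<omega>. \<xi> i \<omega> * \<xi> j \<omega>)"
  using expectation_mult_indep[of "{i}" "{j}" "\<xi> i" "\<xi> j"] assms
  by (auto simp: measurable_\<xi> integrable_\<xi> expectation_\<xi>)

text \<open>The noise at level \<open>m\<close> is centred, uncorrelated between sites and independent of the past, so every
mixed term of the square vanishes.\<close>

lemma second_moment_noise:
  fixes A U W :: "env \<Rightarrow> real"
  assumes AUW: "square_integrable P A" "square_integrable P U" "square_integrable P W"
    and past: "A \<in> borel_measurable (past m)" "U \<in> borel_measurable (past m)"
      "W \<in> borel_measurable (past m)"
    and "x \<noteq> y"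
  shows "expectation (\<lambda>\<omega>. (A \<omega> - \<xi> (x, m) \<omega> * U \<omega> + \<xi> (y, m) \<omega> * W \<omega>)\<^sup>2) =
    expectation (\<lambda>\<omega>. (A \<omega>)\<^sup>2) + beta * (expectation (\<lambda>\<omega>. (U \<omega>)\<^sup>2) + expectation (\<lambda>\<omega>. (W \<omega>)\<^sup>2))"
proof -
  have *: "integrable P (\<lambda>\<omega>. g \<omega> * (F \<omega> * H \<omega>)) \<and>
      expectation (\<lambda>\<omega>. g \<omega> * (F \<omega> * H \<omega>)) = expectation g * expectation (\<lambda>\<omega>. F \<omega> * H \<omega>)"
    if "F \<in> {A, U, W}" "H \<in> {A, U, W}"
      and "integrable P g" "g \<in> borel_measurable (coord_algebra borel {i. snd i = m})" for F H g
  proof -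
    have [measurable]: "F \<in> borel_measurable (past m)" "H \<in> borel_measurable (past m)"
      using that past by auto
    have "integrable P (\<lambda>\<omega>. F \<omega> * H \<omega>)"
      by (rule integrable_mult_square_integrable) (use AUW that in auto)
    moreover have "(\<lambda>\<omega>. F \<omega> * H \<omega>) \<in> borel_measurable (past m)" by measurable
    moreover have "{i :: int \<times> int. snd i = m} \<inter> {i. snd i < m} = {}" by auto
    ultimately show ?thesis
      using expectation_mult_indep that(3,4) by blast
  qed
  let ?x = "\<xi> (x, m)" and ?y = "\<xi> (y, m)"
  have \<xi>m [measurable]: "\<xi> (z, m) \<in> borel_measurable (coord_algebra borel {i. snd i = m})" for z
    by (rule measurable_\<xi>) simp
  have m1: "(\<lambda>\<omega>. (?x \<omega>)\<^sup>2) \<in> borel_measurable (coord_algebra borel {i. snd i = m})"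
    "(\<lambda>\<omega>. (?y \<omega>)\<^sup>2) \<in> borel_measurable (coord_algebra borel {i. snd i = m})"
    "(\<lambda>\<omega>. ?x \<omega> * ?y \<omega>) \<in> borel_measurable (coord_algebra borel {i. snd i = m})"
    by measurable
  have ne: "(x, m) \<noteq> (y, m)" using \<open>x \<noteq> y\<close> by simp
  note t1 = *[of U U, OF _ _ integrable_\<xi>_power2 m1(1)]
  note t2 = *[of W W, OF _ _ integrable_\<xi>_power2 m1(2)]
  note t3 = *[of A U, OF _ _ integrable_\<xi> \<xi>m, of x]
  note t4 = *[of A W, OF _ _ integrable_\<xi> \<xi>m, of y]
  note t5 = *[of U W, OF _ _ expectation_\<xi>_mult_\<xi>(2)[OF ne] m1(3)]
  have eq: "(A \<omega> - ?x \<omega> * U \<omega> + ?y \<omega> * W \<omega>)\<^sup>2 =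
      (A \<omega>)\<^sup>2 + (?x \<omega>)\<^sup>2 * (U \<omega> * U \<omega>) + (?y \<omega>)\<^sup>2 * (W \<omega> * W \<omega>)
      - 2 * (?x \<omega> * (A \<omega> * U \<omega>)) + 2 * (?y \<omega> * (A \<omega> * W \<omega>))
      - 2 * ((?x \<omega> * ?y \<omega>) * (U \<omega> * W \<omega>))" for \<omega>
    by (simp add: power2_eq_square algebra_simps)
  show ?thesis
    unfolding eq power2_eq_square[of "U _"] power2_eq_square[of "W _"]
    using t1 t2 t3 t4 t5 square_integrable_power2[OF AUW(1)] expectation_\<xi>_mult_\<xi>(1)[OF ne]
    by (simp add: expectation_\<xi> expectation_\<xi>_power2 distrib_left)
qed

text \<open>For the centred profile, a step is the average of two neighbours minus the noise \<open>\<xi> (x, m)\<close> times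
\<open>1 + D x - D (x - 1)\<close>, the mean number of particles at \<open>x\<close>. The second moment of the latter is
\<open>1 + s 1\<close>, and the squared differences of averages expand into squared differences of single sites, so
that the gap function alone determines its successor.\<close>

lemma evolve_step:
  fixes D :: "int \<Rightarrow> env \<Rightarrow> real"
  assumes past: "\<And>x. D x \<in> borel_measurable (past m)"
    and L2: "\<And>x. square_integrable P (D x)"
    and mean: "\<And>x. expectation (D x) = 0"
    and s: "\<And>x y. expectation (\<lambda>\<omega>. (D x \<omega> - D y \<omega>)\<^sup>2) = s (x - y)"
    and step: "\<And>x. D' x = (\<lambda>\<omega>. (1 - \<omega> (x, m)) * D x \<omega> + \<omega> (x, m) * D (x - 1) \<omega> + (1 / 2 - \<omega> (x, m)))"
  shows "square_integrable P (D' x)"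
    and "expectation (D' x) = 0"
    and "expectation (\<lambda>\<omega>. (D' x \<omega>)\<^sup>2) =
      (expectation (\<lambda>\<omega>. (D x \<omega>)\<^sup>2) + expectation (\<lambda>\<omega>. (D (x - 1) \<omega>)\<^sup>2)) / 2
        - s 1 / 4 + beta * (1 + s 1)"
    and "x \<noteq> y \<Longrightarrow> expectation (\<lambda>\<omega>. (D' x \<omega> - D' y \<omega>)\<^sup>2) =
      (2 * s (x - y) + s (x - y + 1) + s (x - y - 1) - 2 * s 1) / 4 + 2 * beta * (1 + s 1)"
proof -
  define A where "A x \<omega> = (D x \<omega> + D (x - 1) \<omega>) / 2" for x \<omega>
  define U where "U x \<omega> = 1 + (D x \<omega> - D (x - 1) \<omega>)" for x \<omega>
  have D': "D' x = (\<lambda>\<omega>. A x \<omega> - \<xi> (x, m) \<omega> * U x \<omega>)" for x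
    by (auto simp: step A_def U_def \<xi>_def field_simps)
  have A: "square_integrable P (A x)" for x
    unfolding A_def[abs_def] using square_integrable_cmult[OF square_integrable_add[OF L2 L2], of "1/2"]
    by simp
  have U: "square_integrable P (U x)" for x
    unfolding U_def[abs_def]
    by (intro square_integrable_add square_integrable_const square_integrable_diff L2)
  have [measurable]: "D x \<in> borel_measurable (past m)" for x by (rule past)
  have A_past [measurable]: "A x \<in> borel_measurable (past m)" for x
    unfolding A_def[abs_def] by measurable
  have U_past [measurable]: "U x \<in> borel_measurable (past m)" for x
    unfolding U_def[abs_def] by measurable
  note int = integrable_square_integrable[OF L2]
  have disj: "{i :: int \<times> int. snd i = m} \<inter> {i. snd i < m} = {}" by auto
  show "square_integrable P (D' x)"
    unfolding D'
    by (intro square_integrable_diff A square_integrable_mult_bounded[OF U, where c = 1]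
        measurable_coord_algebra_P[OF measurable_\<xi>[of _ UNIV]] \<xi>_bound) auto
  have "integrable P (\<lambda>\<omega>. \<xi> (x, m) \<omega> * U x \<omega>)" "expectation (\<lambda>\<omega>. \<xi> (x, m) \<omega> * U x \<omega>) = 0"
    using expectation_mult_indep[OF disj measurable_\<xi> integrable_\<xi> U_past
        integrable_square_integrable[OF U]]
    by (auto simp: expectation_\<xi>)
  moreover have "expectation (A x) = 0"
    unfolding A_def[abs_def] by (simp add: int mean)
  ultimately show "expectation (D' x) = 0"
    unfolding D' by (simp add: integrable_square_integrable[OF A])
  have DD: "integrable P (\<lambda>\<omega>. (D x \<omega> - D y \<omega>)\<^sup>2)" for x y
    by (intro square_integrable_power2 square_integrable_diff L2)
  have D2: "integrable P (\<lambda>\<omega>. (D x \<omega>)\<^sup>2)" for x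
    by (intro square_integrable_power2 L2)
  have U2: "expectation (\<lambda>\<omega>. (U x \<omega>)\<^sup>2) = 1 + s 1" for x
  proof -
    have "(U x \<omega>)\<^sup>2 = 1 + 2 * D x \<omega> - 2 * D (x - 1) \<omega> + (D x \<omega> - D (x - 1) \<omega>)\<^sup>2" for \<omega>
      by (simp add: U_def power2_eq_square algebra_simps)
    then have "expectation (\<lambda>\<omega>. (U x \<omega>)\<^sup>2) = 1 + expectation (\<lambda>\<omega>. (D x \<omega> - D (x - 1) \<omega>)\<^sup>2)"
      using int DD by (simp add: mean prob_space)
    then show ?thesis using s[of x "x - 1"] by simp
  qed
  have zero: "square_integrable P (\<lambda>_. 0)" by (rule square_integrable_const)
  have "expectation (\<lambda>\<omega>. (D' x \<omega>)\<^sup>2) = expectation (\<lambda>\<omega>. (A x \<omega>)\<^sup>2) + beta * (1 + s 1)"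
    unfolding D' using second_moment_noise[OF A U zero A_past U_past, of x "x + 1" x x]
    by (simp add: U2)
  moreover have "(A x \<omega>)\<^sup>2 = (D x \<omega>)\<^sup>2 / 2 + (D (x - 1) \<omega>)\<^sup>2 / 2 - (D x \<omega> - D (x - 1) \<omega>)\<^sup>2 / 4" for \<omega>
    by (simp add: A_def power2_eq_square field_simps)
  ultimately show "expectation (\<lambda>\<omega>. (D' x \<omega>)\<^sup>2) =
      (expectation (\<lambda>\<omega>. (D x \<omega>)\<^sup>2) + expectation (\<lambda>\<omega>. (D (x - 1) \<omega>)\<^sup>2)) / 2
        - s 1 / 4 + beta * (1 + s 1)"
    using s[of x "x - 1"] by (simp add: DD D2 field_simps)
  assume "x \<noteq> y"
  have "expectation (\<lambda>\<omega>. (D' x \<omega> - D' y \<omega>)\<^sup>2) =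
      expectation (\<lambda>\<omega>. (A x \<omega> - A y \<omega> - \<xi> (x, m) \<omega> * U x \<omega> + \<xi> (y, m) \<omega> * U y \<omega>)\<^sup>2)"
    unfolding D' by (simp add: algebra_simps)
  also have "\<dots> = expectation (\<lambda>\<omega>. (A x \<omega> - A y \<omega>)\<^sup>2) + 2 * beta * (1 + s 1)"
    using second_moment_noise[OF square_integrable_diff[OF A A] U U _ U_past U_past \<open>x \<noteq> y\<close>]
    by (simp add: U2)
  finally have 1: "expectation (\<lambda>\<omega>. (D' x \<omega> - D' y \<omega>)\<^sup>2) =
      expectation (\<lambda>\<omega>. (A x \<omega> - A y \<omega>)\<^sup>2) + 2 * beta * (1 + s 1)" .
  have sq: "(A x \<omega> - A y \<omega>)\<^sup>2 =
      ((D x \<omega> - D y \<omega>)\<^sup>2 + (D x \<omega> - D (y - 1) \<omega>)\<^sup>2 + (D (x - 1) \<omega> - D y \<omega>)\<^sup>2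
        + (D (x - 1) \<omega> - D (y - 1) \<omega>)\<^sup>2 - (D x \<omega> - D (x - 1) \<omega>)\<^sup>2
        - (D y \<omega> - D (y - 1) \<omega>)\<^sup>2) / 4" for \<omega>
    by (simp add: A_def power2_eq_square field_simps)
  have "expectation (\<lambda>\<omega>. (A x \<omega> - A y \<omega>)\<^sup>2) =
      (s (x - y) + s (x - (y - 1)) + s (x - 1 - y) + s (x - 1 - (y - 1)) - s 1 - s 1) / 4"
    unfolding sq using s[of x "x - 1"] s[of y "y - 1"] by (simp add: DD s)
  moreover have "x - (y - 1) = x - y + 1" "x - 1 - y = x - y - 1" "x - 1 - (y - 1) = x - y"
    by auto
  ultimately show "expectation (\<lambda>\<omega>. (D' x \<omega> - D' y \<omega>)\<^sup>2) =
      (2 * s (x - y) + s (x - y + 1) + s (x - y - 1) - 2 * s 1) / 4 + 2 * beta * (1 + s 1)"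
    using 1 by simp
qed

end

section \<open>Growth of second moments along the evolution\<close>

context fair_environment
begin

text \<open>The variance of the stationary density; it equals \<open>1 / (4 \<alpha>) - 1\<close>.\<close>

definition sigma2 :: real where
  "sigma2 = beta / alpha P"

lemma sigma2_nonneg: "0 \<le> sigma2"
  using beta_nonneg alpha_pos by (simp add: sigma2_def)

text \<open>The second equation expresses the balance between the variance \<open>beta (1 + \<sigma>\<^sup>2)\<close> injected by the noise
and the loss \<open>\<sigma>\<^sup>2 / 4\<close> through averaging of neighbouring heights.\<close>

lemma beta_eq: "beta = alpha P * sigma2" "beta * (1 + sigma2) = sigma2 / 4"
proof -
  show 1: "beta = alpha P * sigma2" using alpha_pos by (simp add: sigma2_def)
  have 2: "alpha P * (1 + sigma2) = 1 / 4"
    using 1 unfolding beta_def by (simp add: distrib_left)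
  have "beta * (1 + sigma2) = sigma2 * (alpha P * (1 + sigma2))"
    using 1 by simp
  then show "beta * (1 + sigma2) = sigma2 / 4"
    unfolding 2 by simp
qed

text \<open>The action of a time step on gap functions \<open>g (x - y) = E (D x - D y)\<^sup>2\<close>, according to
\<open>evolve_step\<close>. The value at \<open>0\<close> is separate because the noise at a single site cancels in the
difference.\<close>

definition gap_step :: "(int \<Rightarrow> real) \<Rightarrow> int \<Rightarrow> real" where
  "gap_step g r = (if r = 0 then 0
     else (2 * g r + g (r + 1) + g (r - 1) - 2 * g 1) / 4 + 2 * beta * (1 + g 1))"

lemma gap_step_stationary: "gap_step (\<lambda>r. sigma2 * \<bar>of_int r\<bar>) = (\<lambda>r. sigma2 * \<bar>of_int r\<bar>)"
proof
  fix r :: int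
  show "gap_step (\<lambda>r. sigma2 * \<bar>of_int r\<bar>) r = sigma2 * \<bar>of_int r\<bar>"
  proof (cases "r = 0")
    case False
    then have "\<bar>of_int r + 1\<bar> + \<bar>of_int r - 1\<bar> = 2 * \<bar>of_int r :: real\<bar>"
      by (cases "0 < r") auto
    then have 1: "sigma2 * \<bar>of_int r + 1\<bar> + sigma2 * \<bar>of_int r - 1\<bar> = 2 * (sigma2 * \<bar>of_int r\<bar>)"
      by (metis distrib_left mult.left_commute)
    have "gap_step (\<lambda>r. sigma2 * \<bar>of_int r\<bar>) r = (2 * (sigma2 * \<bar>of_int r\<bar>)
        + (sigma2 * \<bar>of_int r + 1\<bar> + sigma2 * \<bar>of_int r - 1\<bar>) - 2 * sigma2) / 4 + 2 * (beta * (1 + sigma2))"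
      using False by (simp add: gap_step_def)
    then show ?thesis unfolding 1 beta_eq(2) by (simp add: field_simps)
  qed (simp add: gap_step_def)
qed

text \<open>The drift \<open>1 / 2\<close> per step is the mean number of particles that cross a fixed site.\<close>

definition centred :: "(int \<Rightarrow> env \<Rightarrow> real) \<Rightarrow> int \<Rightarrow> nat \<Rightarrow> int \<Rightarrow> env \<Rightarrow> real" where
  "centred h s k x \<omega> = evolve \<omega> (\<lambda>y. h y \<omega>) s k x - (of_int x - real k / 2)"

lemma centred_Suc:
  "centred h s (Suc k) x = (\<lambda>\<omega>. (1 - \<omega> (x, s + int k)) * centred h s k x \<omega> +
     \<omega> (x, s + int k) * centred h s k (x - 1) \<omega> + (1 / 2 - \<omega> (x, s + int k)))"
  by (rule ext) (simp add: centred_def algebra_simps)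

lemma centred_past:
  assumes "\<And>y. h y \<in> borel_measurable (past s)"
  shows "centred h s k x \<in> borel_measurable (past (s + int k))"
proof -
  have "(\<lambda>\<omega>. evolve \<omega> (\<lambda>y. h y \<omega>) s k x) \<in> borel_measurable (past (s + int k))"
    by (rule measurable_coord_algebra_mono[OF _ _ measurable_evolve[OF assms]]) auto
  then show ?thesis unfolding centred_def[abs_def] by simp
qed

lemma centred_moments:
  assumes h: "\<And>y. h y \<in> borel_measurable (past s)"
    and L2: "\<And>x. square_integrable P (\<lambda>\<omega>. h x \<omega> - of_int x)"
    and mean: "\<And>x. expectation (\<lambda>\<omega>. h x \<omega> - of_int x) = 0"
    and gap: "\<And>x y. expectation (\<lambda>\<omega>. ((h x \<omega> - of_int x) - (h y \<omega> - of_int y))\<^sup>2) = g (x - y)"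
  shows "square_integrable P (centred h s k x)"
    and "expectation (centred h s k x) = 0"
    and "expectation (\<lambda>\<omega>. (centred h s k x \<omega> - centred h s k y \<omega>)\<^sup>2) = (gap_step ^^ k) g (x - y)"
    and "expectation (\<lambda>\<omega>. (centred h s (Suc k) x \<omega>)\<^sup>2) =
      (expectation (\<lambda>\<omega>. (centred h s k x \<omega>)\<^sup>2) + expectation (\<lambda>\<omega>. (centred h s k (x - 1) \<omega>)\<^sup>2)) / 2
        - (gap_step ^^ k) g 1 / 4 + beta * (1 + (gap_step ^^ k) g 1)"
proof -
  have "(\<forall>x. square_integrable P (centred h s k x)) \<and> (\<forall>x. expectation (centred h s k x) = 0) \<and>
    (\<forall>x y. expectation (\<lambda>\<omega>. (centred h s k x \<omega> - centred h s k y \<omega>)\<^sup>2) = (gap_step ^^ k) g (x - y))" for k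
  proof (induction k)
    case 0
    then show ?case
      using L2 mean gap by (simp add: centred_def[abs_def])
  next
    case (Suc k)
    note step = evolve_step[where D = "centred h s k" and D' = "centred h s (Suc k)" and
        s = "(gap_step ^^ k) g", OF centred_past[OF h] _ _ _ centred_Suc]
    show ?case
    proof (intro conjI allI)
      fix x y
      show "square_integrable P (centred h s (Suc k) x)" "expectation (centred h s (Suc k) x) = 0"
        using step(1,2) Suc by blast+
      show "expectation (\<lambda>\<omega>. (centred h s (Suc k) x \<omega> - centred h s (Suc k) y \<omega>)\<^sup>2) =
          (gap_step ^^ Suc k) g (x - y)"
      proof (cases "x = y")
        case False
        have "expectation (\<lambda>\<omega>. (centred h s (Suc k) x \<omega> - centred h s (Suc k) y \<omega>)\<^sup>2) =
            gap_step ((gap_step ^^ k) g) (x - y)"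
          using step(4)[of x y] Suc False unfolding gap_step_def[of "(gap_step ^^ k) g"] by simp
        then show ?thesis by simp
      qed (simp add: gap_step_def)
    qed
  qed
  then show "square_integrable P (centred h s k x)" "expectation (centred h s k x) = 0"
    "expectation (\<lambda>\<omega>. (centred h s k x \<omega> - centred h s k y \<omega>)\<^sup>2) = (gap_step ^^ k) g (x - y)"
    "expectation (\<lambda>\<omega>. (centred h s (Suc k) x \<omega>)\<^sup>2) =
      (expectation (\<lambda>\<omega>. (centred h s k x \<omega>)\<^sup>2) + expectation (\<lambda>\<omega>. (centred h s k (x - 1) \<omega>)\<^sup>2)) / 2
        - (gap_step ^^ k) g 1 / 4 + beta * (1 + (gap_step ^^ k) g 1)"
    using evolve_step(3)[where D = "centred h s k" and D' = "centred h s (Suc k)" and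
        s = "(gap_step ^^ k) g", OF centred_past[OF h] _ _ _ centred_Suc] by auto
qed

text \<open>By linearity, the coefficients of a step can be moved to the test function, which remains a
bounded function of the environment from level \<open>s\<close> on; after all steps are removed, independence applies.\<close>

lemma evolve_orthogonal:
  assumes h: "\<And>y. h y \<in> borel_measurable (past s)" "\<And>y. integrable P (h y)"
      "\<And>y. expectation (h y) = 0"
    and Z: "Z \<in> borel_measurable (future s)" "\<And>\<omega>. \<omega> \<in> space P \<Longrightarrow> \<bar>Z \<omega>\<bar> \<le> c"
  shows "integrable P (\<lambda>\<omega>. evolve \<omega> (\<lambda>y. h y \<omega>) s k x * Z \<omega>) \<and>
    expectation (\<lambda>\<omega>. evolve \<omega> (\<lambda>y. h y \<omega>) s k x * Z \<omega>) = 0"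
  using Z
proof (induction k arbitrary: x Z)
  case 0
  have "integrable P Z"
    by (rule integrable_const_bound[where B = c])
       (use 0 measurable_coord_algebra_P in auto)
  moreover have "{i :: int \<times> int. snd i < s} \<inter> {i. s \<le> snd i} = {}" by auto
  ultimately show ?case
    using expectation_mult_indep[OF _ h(1,2) 0(1)] h(3) by simp
next
  case (Suc k)
  let ?u = "\<lambda>\<omega>. \<omega> (x, s + int k)"
  have [measurable]: "?u \<in> borel_measurable (future s)"
    by (rule measurable_coord_algebra_coordinate) auto
  have [measurable]: "Z \<in> borel_measurable (future s)" by fact
  have *: "integrable P (\<lambda>\<omega>. evolve \<omega> (\<lambda>y. h y \<omega>) s k x * (f (?u \<omega>) * Z \<omega>)) \<and>
    expectation (\<lambda>\<omega>. evolve \<omega> (\<lambda>y. h y \<omega>) s k x * (f (?u \<omega>) * Z \<omega>)) = 0"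
    if [measurable]: "f \<in> borel_measurable borel" and f: "\<And>u. 0 \<le> u \<Longrightarrow> u \<le> 1 \<Longrightarrow> \<bar>f u\<bar> \<le> 1"
    for x and f :: "real \<Rightarrow> real"
  proof (rule Suc.IH)
    show "(\<lambda>\<omega>. f (?u \<omega>) * Z \<omega>) \<in> borel_measurable (future s)" by measurable
    fix \<omega> assume \<omega>: "\<omega> \<in> space P"
    have "\<bar>f (?u \<omega>)\<bar> * \<bar>Z \<omega>\<bar> \<le> 1 * c"
      using env_bounds[OF \<omega>] f Suc.prems(2)[OF \<omega>] by (intro mult_mono) auto
    then show "\<bar>f (?u \<omega>) * Z \<omega>\<bar> \<le> c" by (simp add: abs_mult)
  qed
  have "evolve \<omega> (\<lambda>y. h y \<omega>) s (Suc k) x * Z \<omega> =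
      evolve \<omega> (\<lambda>y. h y \<omega>) s k x * ((1 - ?u \<omega>) * Z \<omega>) +
      evolve \<omega> (\<lambda>y. h y \<omega>) s k (x - 1) * (?u \<omega> * Z \<omega>)" for \<omega>
    by (simp add: algebra_simps)
  then show ?case
    using *[of "\<lambda>u. 1 - u" x] *[of "\<lambda>u. u" "x - 1"] by simp
qed

end

section \<open>The profile that starts flat in the remote past\<close>

text \<open>The sequence \<open>a k 1\<close> converges, and the recursion then determines the limits of all \<open>a k n\<close>: they
form a quadratic polynomial in \<open>n\<close> with leading coefficient proportional to the limit of \<open>a k 1\<close>. The
linear bound excludes a positive leading coefficient.\<close>

lemma quadratic_recursion_tendsto_zero:
  fixes a :: "nat \<Rightarrow> nat \<Rightarrow> real"
  assumes zero: "\<And>k. a k 0 = 0"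
    and rec: "\<And>k n. a (Suc k) (Suc n) =
      (2 * a k (Suc n) + a k (Suc (Suc n)) + a k n) / 4 - 2 * \<alpha> * a k 1"
    and nonneg: "\<And>k. 0 \<le> a k 1" and decr: "\<And>k. a (Suc k) 1 \<le> a k 1"
    and linear: "\<And>k n. a k n \<le> C * real n" and "0 < \<alpha>"
  shows "(\<lambda>k. a k n) \<longlonglongrightarrow> 0"
proof -
  have "decseq (\<lambda>k. a k 1)" using decr by (rule decseq_SucI)
  then obtain l where l: "(\<lambda>k. a k 1) \<longlonglongrightarrow> l"
    using decseq_convergent[of "\<lambda>k. a k 1" 0] nonneg by blast
  \<comment> \<open>The solution of \<open>L (n + 2) - 2 L (n + 1) + L n = 8 \<alpha> l\<close> with \<open>L 0 = 0\<close> and \<open>L 1 = l\<close>.\<close>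
  define L where "L n = l * (real n + 4 * \<alpha> * (real n * (real n - 1)))" for n
  have lim: "(\<lambda>k. a k n) \<longlonglongrightarrow> L n \<and> (\<lambda>k. a k (Suc n)) \<longlonglongrightarrow> L (Suc n)" for n
  proof (induction n)
    case 0
    then show ?case using zero l by (simp add: L_def)
  next
    case (Suc n)
    have "a k (Suc (Suc n)) =
        4 * a (Suc k) (Suc n) - 2 * a k (Suc n) - a k n + 8 * \<alpha> * a k 1" for k
      by (simp add: rec field_simps)
    moreover have "(\<lambda>k. 4 * a (Suc k) (Suc n) - 2 * a k (Suc n) - a k n + 8 * \<alpha> * a k 1)
        \<longlonglongrightarrow> 4 * L (Suc n) - 2 * L (Suc n) - L n + 8 * \<alpha> * l"
      using Suc by (intro tendsto_intros l LIMSEQ_Suc) auto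
    moreover have "4 * L (Suc n) - 2 * L (Suc n) - L n + 8 * \<alpha> * l = L (Suc (Suc n))"
      by (simp add: L_def algebra_simps)
    ultimately show ?case using Suc by simp
  qed
  have "0 \<le> l" by (rule LIMSEQ_le_const[OF l]) (use nonneg in auto)
  moreover have "\<not> 0 < l"
  proof
    assume "0 < l"
    obtain m where m: "C / (4 * \<alpha> * l) < real m" using reals_Archimedean2 by blast
    have "L (Suc m) \<le> C * real (Suc m)"
      by (rule LIMSEQ_le_const2[of "\<lambda>k. a k (Suc m)"]) (use lim linear in blast)+
    then have "real (Suc m) * (l + 4 * \<alpha> * l * real m) \<le> real (Suc m) * C"
      by (simp add: L_def algebra_simps)
    then have "l + 4 * \<alpha> * l * real m \<le> C" by (simp only: mult_le_cancel_left_pos of_nat_0_less_iff zero_less_Suc)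
    moreover have "C < 4 * \<alpha> * l * real m"
      using m \<open>0 < l\<close> \<open>0 < \<alpha>\<close> by (simp add: divide_less_eq mult.commute mult.left_commute)
    ultimately show False using \<open>0 < l\<close> by linarith
  qed
  ultimately have "L n = 0" by (simp add: L_def)
  then show ?thesis using lim by metis
qed

context fair_environment
begin

text \<open>The centred profile at time \<open>0\<close> when the density is identically \<open>1\<close> at time \<open>-N\<close>.\<close>

definition flat :: "nat \<Rightarrow> int \<Rightarrow> env \<Rightarrow> real" where
  "flat N x \<omega> = centred (\<lambda>y _. of_int y) (- int N) N x \<omega>"

lemma flat_window: "flat N x \<in> borel_measurable (coord_algebra borel {i. - int N \<le> snd i \<and> snd i < 0})"
proof -
  have "(\<lambda>\<omega>. evolve \<omega> of_int (- int N) N x) \<in>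
      borel_measurable (coord_algebra borel ({} \<union> {i. - int N \<le> snd i \<and> snd i < - int N + int N}))"
    by (rule measurable_evolve[of "\<lambda>y _. of_int y"]) simp
  then show ?thesis unfolding flat_def[abs_def] centred_def by simp
qed

lemma measurable_flat [measurable]: "flat N x \<in> borel_measurable P"
  using flat_window by (rule measurable_coord_algebra_P)

lemma flat_bound: "\<omega> \<in> space P \<Longrightarrow> \<bar>flat N x \<omega>\<bar> \<le> real N"
  using evolve_flat_bounds[of \<omega> x N "- int N"] env_bounds[of \<omega>]
  by (auto simp: flat_def centred_def abs_le_iff)

lemma flat_moments:
  shows "expectation (flat N x) = 0" "square_integrable P (flat N x)"
    and "expectation (\<lambda>\<omega>. (flat N x \<omega> - flat N y \<omega>)\<^sup>2) = (gap_step ^^ N) (\<lambda>_. 0) (x - y)"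
  unfolding flat_def[abs_def]
  by (rule centred_moments; simp add: square_integrable_const)+

text \<open>Starting from time \<open>-m\<close> instead of \<open>-n\<close> means starting at time \<open>-n\<close> from a profile that differs
from the flat one by a centred function of earlier levels. The evolution is linear and sees only later
levels, so the difference is orthogonal to all bounded functions of these.\<close>

lemma flat_increment_orthogonal:
  assumes "n \<le> m" "Z \<in> borel_measurable (future (- int n))"
    and "\<And>\<omega>. \<omega> \<in> space P \<Longrightarrow> \<bar>Z \<omega>\<bar> \<le> c"
  shows "integrable P (\<lambda>\<omega>. (flat m x \<omega> - flat n x \<omega>) * Z \<omega>)"
    and "expectation (\<lambda>\<omega>. (flat m x \<omega> - flat n x \<omega>) * Z \<omega>) = 0"
proof -
  let ?h = "centred (\<lambda>y _. of_int y) (- int m) (m - n)"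
  have t: "- int m + int (m - n) = - int n" using \<open>n \<le> m\<close> by simp
  have *: "flat m x \<omega> - flat n x \<omega> = evolve \<omega> (\<lambda>y. ?h y \<omega>) (- int n) n x" for \<omega>
  proof -
    have "evolve \<omega> (\<lambda>y. ?h y \<omega>) (- int n) n x =
        evolve \<omega> (\<lambda>y. evolve \<omega> of_int (- int m) (m - n) y - of_int y + (real m - real n) / 2) (- int n) n x"
      unfolding centred_def using \<open>n \<le> m\<close> by (simp add: of_nat_diff algebra_simps)
    also have "\<dots> = evolve \<omega> (evolve \<omega> of_int (- int m) (m - n)) (- int n) n x
        - evolve \<omega> of_int (- int n) n x + (real m - real n) / 2"
      by (simp only: evolve_add_const evolve_diff)
    also have "evolve \<omega> (evolve \<omega> of_int (- int m) (m - n)) (- int n) n x = evolve \<omega> of_int (- int m) m x"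
      using evolve_add_time[of \<omega> of_int "- int m" "m - n" n x] \<open>n \<le> m\<close> t by simp
    finally show ?thesis by (simp add: flat_def centred_def)
  qed
  have past: "?h y \<in> borel_measurable (past (- int n))" for y
    using centred_past[of "\<lambda>y _. of_int y" "- int m" "m - n" y] t by simp
  have mom: "square_integrable P (?h y)" "expectation (?h y) = 0" for y
    by (rule centred_moments[where g = "\<lambda>_. 0"]; simp add: square_integrable_const)+
  have "integrable P (\<lambda>\<omega>. evolve \<omega> (\<lambda>y. ?h y \<omega>) (- int n) n x * Z \<omega>) \<and>
      expectation (\<lambda>\<omega>. evolve \<omega> (\<lambda>y. ?h y \<omega>) (- int n) n x * Z \<omega>) = 0"
    by (rule evolve_orthogonal[OF past integrable_square_integrable[OF mom(1)] mom(2) assms(2,3)])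
  then show "integrable P (\<lambda>\<omega>. (flat m x \<omega> - flat n x \<omega>) * Z \<omega>)"
    "expectation (\<lambda>\<omega>. (flat m x \<omega> - flat n x \<omega>) * Z \<omega>) = 0"
    unfolding * by auto
qed

lemma flat_difference_martingale:
  fixes x y :: int
  defines "X \<equiv> \<lambda>N \<omega>. flat N x \<omega> - flat N y \<omega>"
  shows "X n \<in> borel_measurable P"
    and "k \<le> n \<Longrightarrow> X k \<in> borel_measurable (future (- int n))"
    and "\<omega> \<in> space P \<Longrightarrow> \<bar>X n \<omega>\<bar> \<le> 2 * real n"
    and "n \<le> m \<Longrightarrow> Z \<in> borel_measurable (future (- int n)) \<Longrightarrow>
      (\<And>\<omega>. \<omega> \<in> space P \<Longrightarrow> \<bar>Z \<omega>\<bar> \<le> c) \<Longrightarrow> expectation (\<lambda>\<omega>. (X m \<omega> - X n \<omega>) * Z \<omega>) = 0"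
proof -
  show "X n \<in> borel_measurable P" unfolding X_def by measurable
  show "X k \<in> borel_measurable (future (- int n))" if "k \<le> n"
  proof -
    have "flat k z \<in> borel_measurable (future (- int n))" for z
      by (rule measurable_coord_algebra_mono[OF _ _ flat_window]) (use that in auto)
    then show ?thesis unfolding X_def by simp
  qed
  show "\<bar>X n \<omega>\<bar> \<le> 2 * real n" if "\<omega> \<in> space P"
    using flat_bound[OF that, of n x] flat_bound[OF that, of n y] by (simp add: X_def)
  show "expectation (\<lambda>\<omega>. (X m \<omega> - X n \<omega>) * Z \<omega>) = 0"
    if "n \<le> m" "Z \<in> borel_measurable (future (- int n))" "\<And>\<omega>. \<omega> \<in> space P \<Longrightarrow> \<bar>Z \<omega>\<bar> \<le> c"
  proof -
    have "(X m \<omega> - X n \<omega>) * Z \<omega> = (flat m x \<omega> - flat n x \<omega>) * Z \<omega> - (flat m y \<omega> - flat n y \<omega>) * Z \<omega>" for \<omega>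
      by (simp add: X_def algebra_simps)
    then show ?thesis using flat_increment_orthogonal[OF that] by simp
  qed
qed

abbreviation flat_gap :: "nat \<Rightarrow> int \<Rightarrow> real" where
  "flat_gap N \<equiv> (gap_step ^^ N) (\<lambda>_. 0)"

lemma flat_gap_increment:
  assumes "n \<le> m"
  shows "expectation (\<lambda>\<omega>. ((flat m x \<omega> - flat m y \<omega>) - (flat n x \<omega> - flat n y \<omega>))\<^sup>2) =
    flat_gap m (x - y) - flat_gap n (x - y)"
  unfolding flat_moments(3)[symmetric]
  by (rule bounded_martingale_orthogonal[where X = "\<lambda>N \<omega>. flat N x \<omega> - flat N y \<omega>" and F = "\<lambda>n. future (- int n)" and B = "\<lambda>n. 2 * real n"])
     (use flat_difference_martingale[where x = x and y = y] assms in blast)+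

lemma flat_gap_nonneg: "0 \<le> flat_gap N r"
proof -
  have "0 \<le> expectation (\<lambda>\<omega>. (flat N r \<omega> - flat N 0 \<omega>)\<^sup>2)"
    by (intro integral_nonneg_AE AE_I2) simp
  then show ?thesis unfolding flat_moments(3) by simp
qed

lemma flat_gap_mono: "n \<le> m \<Longrightarrow> flat_gap n r \<le> flat_gap m r"
proof -
  assume "n \<le> m"
  have "0 \<le> expectation (\<lambda>\<omega>. ((flat m r \<omega> - flat m 0 \<omega>) - (flat n r \<omega> - flat n 0 \<omega>))\<^sup>2)"
    by (intro integral_nonneg_AE AE_I2) simp
  then show ?thesis unfolding flat_gap_increment[OF \<open>n \<le> m\<close>] by simp
qed

lemma flat_gap_neg: "flat_gap N (- r) = flat_gap N r"
proof -
  have "expectation (\<lambda>\<omega>. (flat N 0 \<omega> - flat N r \<omega>)\<^sup>2) = expectation (\<lambda>\<omega>. (flat N r \<omega> - flat N 0 \<omega>)\<^sup>2)"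
    by (simp add: power2_commute)
  then show ?thesis unfolding flat_moments(3) by simp
qed

text \<open>\<open>a k n\<close> is the amount by which the gap function falls short of its fixed point. It starts linear,
and a step preserves convexity on the nonnegative integers together with nonnegativity at \<open>1\<close>; for the
latter, the loss \<open>2 \<alpha> a k 1\<close> is controlled by \<open>\<alpha> \<le> 1 / 4\<close>.\<close>

lemma flat_gap_deficit_invariant:
  defines "a \<equiv> \<lambda>k n. sigma2 * real n - flat_gap k (int n)"
  shows "a (Suc k) (Suc n) = (2 * a k (Suc n) + a k (Suc (Suc n)) + a k n) / 4 - 2 * alpha P * a k 1"
    and "a k 0 = 0" and "0 \<le> a k 1" and "0 \<le> a k (Suc (Suc n)) - 2 * a k (Suc n) + a k n"
proof -
  show rec: "a (Suc k) (Suc n) = (2 * a k (Suc n) + a k (Suc (Suc n)) + a k n) / 4 - 2 * alpha P * a k 1" for k n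
  proof -
    have 1: "1 + int n + 1 = int (Suc (Suc n))" "1 + int n - 1 = int n" by auto
    have "2 * beta * (1 + flat_gap k 1) - flat_gap k 1 / 2 =
        2 * alpha P * (sigma2 - flat_gap k 1)"
      using beta_eq(1) by (simp add: beta_def algebra_simps)
    then show ?thesis
      by (simp add: a_def gap_step_def 1 field_simps)
  qed
  show zero: "a k 0 = 0" for k
    by (cases k) (auto simp: a_def gap_step_def)
  have "0 \<le> a k 1 \<and> (\<forall>n. 0 \<le> a k (Suc (Suc n)) - 2 * a k (Suc n) + a k n)"
  proof (induction k)
    case 0
    then show ?case by (simp add: a_def sigma2_nonneg algebra_simps)
  next
    case (Suc k)
    have al: "alpha P \<le> 1 / 4" using beta_nonneg by (simp add: beta_def)
    have c0: "0 \<le> a k 2 - 2 * a k 1"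
      using Suc[THEN conjunct2, rule_format, of 0] zero by (simp add: numeral_2_eq_2)
    have al1: "alpha P * a k 1 \<le> a k 1 / 4" "0 \<le> alpha P * a k 1"
      using mult_right_mono[OF al, of "a k 1"] Suc alpha_pos by auto
    have "a (Suc k) 1 = a k 1 / 2 + a k 2 / 4 - 2 * (alpha P * a k 1)"
      using rec[of k 0] zero by (simp add: numeral_2_eq_2)
    then have "0 \<le> a (Suc k) 1" using c0 al1 Suc by linarith
    moreover have "0 \<le> a (Suc k) (Suc (Suc n)) - 2 * a (Suc k) (Suc n) + a (Suc k) n" for n
    proof (cases n)
      case 0
      have r: "a (Suc k) 1 = a k 1 / 2 + a k 2 / 4 - 2 * (alpha P * a k 1)"
        "a (Suc k) 2 = a k 2 / 2 + a k 3 / 4 + a k 1 / 4 - 2 * (alpha P * a k 1)"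
        using rec[of k 0] rec[of k 1] zero by (simp_all add: numeral_2_eq_2 numeral_3_eq_3)
      have c1: "0 \<le> a k 3 - 2 * a k 2 + a k 1"
        using Suc[THEN conjunct2, rule_format, of 1] by (simp add: numeral_2_eq_2 numeral_3_eq_3)
      have "0 \<le> a (Suc k) 2 - 2 * a (Suc k) 1"
        using r c0 c1 al1 by linarith
      then show ?thesis using 0 zero by (simp add: numeral_2_eq_2)
    next
      case (Suc m)
      have c: "0 \<le> a k (Suc (Suc n)) - 2 * a k (Suc n) + a k n" for n
        using \<open>0 \<le> a k 1 \<and> _\<close> by blast
      have r: "a (Suc k) (Suc j) =
          a k (Suc j) / 2 + a k (Suc (Suc j)) / 4 + a k j / 4 - 2 * (alpha P * a k 1)" for j
        unfolding rec by (simp add: add_divide_distrib)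
      show ?thesis
        unfolding Suc using r[of m] r[of "Suc m"] r[of "Suc (Suc m)"]
          c[of m] c[of "Suc m"] c[of "Suc (Suc m)"] by linarith
    qed
    ultimately show ?case by blast
  qed
  then show "0 \<le> a k 1" "0 \<le> a k (Suc (Suc n)) - 2 * a k (Suc n) + a k n" by auto
qed

text \<open>The deficit at \<open>1\<close> decreases in \<open>N\<close> by the martingale property and is nonnegative by the preceding
invariant; it is at most linear because gaps, being second moments, are nonnegative.\<close>

lemma flat_gap_limit: "(\<lambda>N. flat_gap N r) \<longlonglongrightarrow> sigma2 * \<bar>of_int r\<bar>"
proof -
  let ?a = "\<lambda>k n. sigma2 * real n - flat_gap k (int n)"
  have "(\<lambda>k. ?a k n) \<longlonglongrightarrow> 0" for n
  proof (rule quadratic_recursion_tendsto_zero[where C = sigma2 and \<alpha> = "alpha P"])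
    show "?a (Suc k) 1 \<le> ?a k 1" for k
      using flat_gap_mono[of k "Suc k" 1] by simp
    show "?a k n \<le> sigma2 * real n" for k n
      using flat_gap_nonneg by simp
  qed (use flat_gap_deficit_invariant alpha_pos in auto)
  from tendsto_diff[OF tendsto_const[of "sigma2 * real (nat \<bar>r\<bar>)"] this[of "nat \<bar>r\<bar>"]]
  have "(\<lambda>N. flat_gap N \<bar>r\<bar>) \<longlonglongrightarrow> sigma2 * \<bar>of_int r\<bar>" by simp
  moreover have "flat_gap N \<bar>r\<bar> = flat_gap N r" for N
    by (cases "0 \<le> r") (auto simp: flat_gap_neg abs_if)
  ultimately show ?thesis by simp
qed

end

section \<open>The stationary profile and its fluctuations\<close>

context fair_environment
begin

definition density_approx :: "nat \<Rightarrow> int \<Rightarrow> env \<Rightarrow> real" where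
  "density_approx N x \<omega> = evolve \<omega> of_int (- int N) N x - evolve \<omega> of_int (- int N) N (x - 1)"

text \<open>The density at site \<open>x\<close>. The maximum with \<open>0\<close> matters only where the limit does not exist. There
the Poisson law clips its parameter in the same way, so the identity with the quenched mean current
holds for all environments, and the function stays measurable.\<close>

definition site_density :: "int \<Rightarrow> env \<Rightarrow> real" where
  "site_density x \<omega> = max 0 (lim (\<lambda>N. density_approx N x \<omega>))"

text \<open>The profile at time \<open>0\<close> whose evolution is the quenched mean current.\<close>

definition initial_profile :: "int \<Rightarrow> env \<Rightarrow> real" where
  "initial_profile x \<omega> = (\<Sum>i\<in>{1..x}. site_density i \<omega>) - (\<Sum>i\<in>{x + 1..0}. site_density i \<omega>)"

lemma density_approx_flat: "density_approx N x \<omega> = 1 + (flat N x \<omega> - flat N (x - 1) \<omega>)"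
  by (simp add: density_approx_def flat_def centred_def)

lemma density_approx_nonneg: "\<omega> \<in> space P \<Longrightarrow> 0 \<le> density_approx N x \<omega>"
  using evolve_mono[of \<omega> of_int "- int N" N x] env_bounds[of \<omega>] by (simp add: density_approx_def)

lemma site_density_past: "site_density x \<in> borel_measurable (past 0)"
proof -
  have [measurable]: "flat N y \<in> borel_measurable (past 0)" for N y
    by (rule measurable_coord_algebra_mono[OF _ _ flat_window]) auto
  have [measurable]: "density_approx N x \<in> borel_measurable (past 0)" for N
    unfolding density_approx_flat[abs_def] by measurable
  show ?thesis unfolding site_density_def[abs_def] by measurable
qed

lemma initial_profile_0 [simp]: "initial_profile 0 \<omega> = 0"
  by (simp add: initial_profile_def)

lemma initial_profile_diff: "initial_profile x \<omega> = initial_profile (x - 1) \<omega> + site_density x \<omega>"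
proof (cases "1 \<le> x")
  case True
  then have "{1..x} = insert x {1..x - 1}" by auto
  with True show ?thesis by (simp add: initial_profile_def)
next
  case False
  then have "{x - 1 + 1..0} = insert x {x + 1..0}" by auto
  with False show ?thesis by (simp add: initial_profile_def)
qed

lemma initial_profile_past: "initial_profile x \<in> borel_measurable (past 0)"
  unfolding initial_profile_def[abs_def] using site_density_past by simp

lemma flat_gap_le: "flat_gap N r \<le> sigma2 * \<bar>of_int r\<bar>"
  by (rule incseq_le[OF incseq_SucI flat_gap_limit]) (rule flat_gap_mono, simp)

lemma AE_density_approx_tendsto: "AE \<omega> in P. \<forall>x. (\<lambda>N. density_approx N x \<omega>) \<longlonglongrightarrow> site_density x \<omega>"
  unfolding AE_all_countable
proof
  fix x
  have "AE \<omega> in P. convergent (\<lambda>N. flat N x \<omega> - flat N (x - 1) \<omega>)"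
  proof (rule bounded_martingale_convergence[where F = "\<lambda>n. future (- int n)"
        and B = "\<lambda>n. 2 * real n" and C = "sigma2"])
    show "expectation (\<lambda>\<omega>. (flat n x \<omega> - flat n (x - 1) \<omega>)\<^sup>2) \<le> sigma2" for n
      unfolding flat_moments(3) using flat_gap_le[of n 1] by simp
  qed (use flat_difference_martingale[where x = x and y = "x - 1"] in blast)+
  then show "AE \<omega> in P. (\<lambda>N. density_approx N x \<omega>) \<longlonglongrightarrow> site_density x \<omega>"
  proof (rule AE_mp, intro AE_I2 impI)
    fix \<omega> assume \<omega>: "\<omega> \<in> space P" and "convergent (\<lambda>N. flat N x \<omega> - flat N (x - 1) \<omega>)"
    then have "convergent (\<lambda>N. density_approx N x \<omega>)"
      unfolding density_approx_flat by (intro convergent_add convergent_const)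
    then have lim: "(\<lambda>N. density_approx N x \<omega>) \<longlonglongrightarrow> lim (\<lambda>N. density_approx N x \<omega>)"
      by (simp add: convergent_LIMSEQ_iff)
    moreover have "0 \<le> lim (\<lambda>N. density_approx N x \<omega>)"
      by (rule LIMSEQ_le_const[OF lim]) (use density_approx_nonneg[OF \<omega>] in auto)
    ultimately show "(\<lambda>N. density_approx N x \<omega>) \<longlonglongrightarrow> site_density x \<omega>"
      by (simp add: site_density_def)
  qed
qed

text \<open>Differences of heights are telescoping sums of finitely many densities.\<close>

lemma AE_flat_tendsto: "AE \<omega> in P. \<forall>x y. (\<lambda>N. flat N x \<omega> - flat N y \<omega>) \<longlonglongrightarrow>
    (initial_profile x \<omega> - of_int x) - (initial_profile y \<omega> - of_int y)"
  using AE_density_approx_tendsto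
proof eventually_elim
  case (elim \<omega>)
  have step: "(\<lambda>N. flat N x \<omega> - flat N (x - 1) \<omega>) \<longlonglongrightarrow> site_density x \<omega> - 1" for x
    using tendsto_diff[OF elim[rule_format, of x] tendsto_const[of 1]] by (simp add: density_approx_flat)
  have "(\<lambda>N. flat N x \<omega> - flat N 0 \<omega>) \<longlonglongrightarrow> initial_profile x \<omega> - of_int x" for x
  proof (induction x rule: int_induct[where k = 0])
    case base
    show ?case by simp
  next
    case (step1 i)
    show ?case
      using tendsto_add[OF step1.IH step[of "i + 1"]] initial_profile_diff[of "i + 1" \<omega>] by (simp add: algebra_simps)
  next
    case (step2 i)
    show ?case
      using tendsto_diff[OF step2.IH step[of i]] initial_profile_diff[of i \<omega>] by (simp add: algebra_simps)
  qed
  from tendsto_diff[OF this this] show ?case by (simp add: algebra_simps)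
qed

text \<open>The differences of flat profiles converge almost surely and in \<open>L\<^sup>2\<close>, so their gap functions converge to
that of the limit.\<close>

lemma initial_profile_moments:
  shows "square_integrable P (\<lambda>\<omega>. initial_profile x \<omega> - of_int x)"
    and "expectation (\<lambda>\<omega>. initial_profile x \<omega> - of_int x) = 0"
    and "expectation (\<lambda>\<omega>. ((initial_profile x \<omega> - of_int x) - (initial_profile y \<omega> - of_int y))\<^sup>2) =
      sigma2 * \<bar>of_int (x - y)\<bar>"
proof -
  have *: "square_integrable P (\<lambda>\<omega>. (initial_profile x \<omega> - of_int x) - (initial_profile y \<omega> - of_int y)) \<and>
    expectation (\<lambda>\<omega>. (initial_profile x \<omega> - of_int x) - (initial_profile y \<omega> - of_int y)) = 0 \<and>
    expectation (\<lambda>\<omega>. ((initial_profile x \<omega> - of_int x) - (initial_profile y \<omega> - of_int y))\<^sup>2) =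
      sigma2 * \<bar>of_int (x - y)\<bar>" for x y
  proof -
    let ?X = "\<lambda>N \<omega>. flat N x \<omega> - flat N y \<omega>"
    let ?Y = "\<lambda>\<omega>. (initial_profile x \<omega> - of_int x) - (initial_profile y \<omega> - of_int y)"
    let ?\<delta> = "\<lambda>n. sigma2 * \<bar>of_int (x - y)\<bar> - flat_gap n (x - y)"
    have [measurable]: "initial_profile z \<in> borel_measurable P" for z
      using initial_profile_past by (rule measurable_coord_algebra_P)
    have X: "square_integrable P (?X n)" for n
      by (intro square_integrable_diff flat_moments)
    have lim: "AE \<omega> in P. (\<lambda>N. ?X N \<omega>) \<longlonglongrightarrow> ?Y \<omega>"
      using AE_flat_tendsto by eventually_elim blast
    have cauchy: "expectation (\<lambda>\<omega>. (?X m \<omega> - ?X n \<omega>)\<^sup>2) \<le> ?\<delta> n" if "n \<le> m" for n m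
      unfolding flat_gap_increment[OF that] using flat_gap_le[of m "x - y"] by simp
    have \<delta>: "?\<delta> \<longlonglongrightarrow> 0"
      using tendsto_diff[OF tendsto_const[of "sigma2 * \<bar>of_int (x - y)\<bar>"] flat_gap_limit[of "x - y"]]
      by simp
    have Y: "?Y \<in> borel_measurable P" by measurable
    have L: "square_integrable P ?Y"
      "(\<lambda>n. expectation (?X n)) \<longlonglongrightarrow> expectation ?Y"
      "(\<lambda>n. expectation (\<lambda>\<omega>. (?X n \<omega>)\<^sup>2)) \<longlonglongrightarrow> expectation (\<lambda>\<omega>. (?Y \<omega>)\<^sup>2)"
      by (rule square_integrable_limit[OF X Y lim cauchy \<delta>]; assumption)+
    have "expectation ?Y = 0"
      using L(2) flat_moments(1) integrable_square_integrable[OF flat_moments(2)]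
      by (simp add: LIMSEQ_const_iff)
    moreover have "expectation (\<lambda>\<omega>. (?Y \<omega>)\<^sup>2) = sigma2 * \<bar>of_int (x - y)\<bar>"
      using L(3) unfolding flat_moments(3) by (rule LIMSEQ_unique) (rule flat_gap_limit)
    ultimately show ?thesis using L(1) by blast
  qed
  show "square_integrable P (\<lambda>\<omega>. initial_profile x \<omega> - of_int x)"
    "expectation (\<lambda>\<omega>. initial_profile x \<omega> - of_int x) = 0"
    using *[of x 0] by simp_all
  show "expectation (\<lambda>\<omega>. ((initial_profile x \<omega> - of_int x) - (initial_profile y \<omega> - of_int y))\<^sup>2) =
      sigma2 * \<bar>of_int (x - y)\<bar>"
    using * by blast
qed

abbreviation stationary_gap :: "int \<Rightarrow> real" where
  "stationary_gap \<equiv> \<lambda>r. sigma2 * \<bar>of_int r\<bar>"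

lemma funpow_gap_step_stationary: "(gap_step ^^ k) stationary_gap = stationary_gap"
  by (induction k) (simp_all add: gap_step_stationary)

abbreviation fluctuation :: "nat \<Rightarrow> int \<Rightarrow> env \<Rightarrow> real" where
  "fluctuation \<equiv> centred initial_profile 0"

lemma fluctuation_moments:
  shows "square_integrable P (fluctuation k x)"
    and "expectation (fluctuation k x) = 0"
    and "expectation (\<lambda>\<omega>. (fluctuation k x \<omega> - fluctuation k y \<omega>)\<^sup>2) = stationary_gap (x - y)"
  using centred_moments(1-3)[OF initial_profile_past initial_profile_moments(1,2), of stationary_gap k x]
    initial_profile_moments(3) by (simp_all add: funpow_gap_step_stationary)

text \<open>Subtracting the height at \<open>(x, m)\<close> from the profile at time \<open>m\<close> leaves a profile with the stationary
gap function, so the variance evolves by averaging; it starts as \<open>\<sigma>\<^sup>2 \<bar>y - x\<bar>\<close>.\<close>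

lemma fluctuation_increment:
  "expectation (\<lambda>\<omega>. (fluctuation (m + k) y \<omega> - fluctuation m x \<omega>)\<^sup>2) = sigma2 * mean_abs k (y - x)"
proof -
  define h where "h z \<omega> = fluctuation m z \<omega> - fluctuation m x \<omega> + of_int z" for z \<omega>
  have shifted: "fluctuation (m + k) y \<omega> - fluctuation m x \<omega> = centred h (int m) k y \<omega>" for k y \<omega>
  proof -
    have "evolve \<omega> (\<lambda>z. h z \<omega>) (int m) k y =
        evolve \<omega> (\<lambda>z. evolve \<omega> (\<lambda>u. initial_profile u \<omega>) 0 m z + (real m / 2 - fluctuation m x \<omega>)) (int m) k y"
      by (simp add: h_def centred_def algebra_simps)
    also have "\<dots> = evolve \<omega> (\<lambda>u. initial_profile u \<omega>) 0 (m + k) y + (real m / 2 - fluctuation m x \<omega>)"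
      unfolding evolve_add_const evolve_add_time by simp
    finally show ?thesis by (simp add: centred_def add_divide_distrib)
  qed
  have past: "h z \<in> borel_measurable (past (int m))" for z
    using centred_past[where h = initial_profile and s = 0 and k = m, OF initial_profile_past] unfolding h_def[abs_def] by simp
  have L2: "square_integrable P (\<lambda>\<omega>. h z \<omega> - of_int z)" for z
    unfolding h_def using fluctuation_moments(1) by (simp add: square_integrable_diff)
  have mean: "expectation (\<lambda>\<omega>. h z \<omega> - of_int z) = 0" for z
    unfolding h_def using fluctuation_moments(2) integrable_square_integrable[OF fluctuation_moments(1)]
    by simp
  have gap: "expectation (\<lambda>\<omega>. ((h u \<omega> - of_int u) - (h v \<omega> - of_int v))\<^sup>2) = stationary_gap (u - v)" for u v
    unfolding h_def using fluctuation_moments(3) by simp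
  have "expectation (\<lambda>\<omega>. (centred h (int m) k y \<omega>)\<^sup>2) = sigma2 * mean_abs k (y - x)"
  proof (induction k arbitrary: y)
    case 0
    show ?case
      using shifted[of 0 y] fluctuation_moments(3)[of m y x] by simp
  next
    case (Suc k)
    have "y - 1 - x = y - x - 1" by simp
    then show ?case
      unfolding centred_moments(4)[OF past L2 mean gap] Suc funpow_gap_step_stationary
      using beta_eq(2) by (simp add: field_simps)
  qed
  then show ?thesis unfolding shifted .
qed

text \<open>Polarisation; the height at the origin at time \<open>0\<close> vanishes, so second moments are also increments.\<close>

lemma fluctuation_covariance:
  "expectation (\<lambda>\<omega>. fluctuation m x \<omega> * fluctuation (m + k) y \<omega>) =
    sigma2 / 2 * (mean_abs m x + mean_abs (m + k) y - mean_abs k (y - x))"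
proof -
  have zero: "fluctuation 0 0 \<omega> = 0" for \<omega>
    by (simp add: centred_def)
  have var: "expectation (\<lambda>\<omega>. (fluctuation k x \<omega>)\<^sup>2) = sigma2 * mean_abs k x" for k x
    using fluctuation_increment[of 0 k x 0] by (simp add: zero)
  note L2 = fluctuation_moments(1)
  have eq: "fluctuation m x \<omega> * fluctuation (m + k) y \<omega> = ((fluctuation m x \<omega>)\<^sup>2 +
      (fluctuation (m + k) y \<omega>)\<^sup>2 - (fluctuation (m + k) y \<omega> - fluctuation m x \<omega>)\<^sup>2) / 2" for \<omega>
    by (simp add: power2_eq_square algebra_simps)
  have "expectation (\<lambda>\<omega>. fluctuation m x \<omega> * fluctuation (m + k) y \<omega>) =
      (expectation (\<lambda>\<omega>. (fluctuation m x \<omega>)\<^sup>2) + expectation (\<lambda>\<omega>. (fluctuation (m + k) y \<omega>)\<^sup>2)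
        - expectation (\<lambda>\<omega>. (fluctuation (m + k) y \<omega> - fluctuation m x \<omega>)\<^sup>2)) / 2"
    unfolding eq
    using square_integrable_power2[OF L2] square_integrable_power2[OF square_integrable_diff[OF L2 L2]]
    by simp
  then show ?thesis
    unfolding var fluctuation_increment by (simp add: algebra_simps)
qed

lemma covariance_evolve_initial:
  "covariance P (\<lambda>\<omega>. evolve \<omega> (\<lambda>z. initial_profile z \<omega>) 0 m x) (\<lambda>\<omega>. evolve \<omega> (\<lambda>z. initial_profile z \<omega>) 0 (m + k) y) =
    sigma2 / 2 * (mean_abs m x + mean_abs (m + k) y - mean_abs k (y - x))"
proof -
  have eq: "evolve \<omega> (\<lambda>z. initial_profile z \<omega>) 0 j z = fluctuation j z \<omega> + (of_int z - real j / 2)" for j z \<omega>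
    by (simp add: centred_def)
  have mean: "expectation (\<lambda>\<omega>. fluctuation j z \<omega> + (of_int z - real j / 2)) = of_int z - real j / 2" for j z
    using fluctuation_moments(2) integrable_square_integrable[OF fluctuation_moments(1)]
    by (simp add: prob_space)
  show ?thesis
    unfolding covariance_def eq mean using fluctuation_covariance by simp
qed

end

section \<open>The quenched mean current as a height\<close>

text \<open>The position at time \<open>k\<close> does not use coins of time \<open>k\<close> or later; this is the source of the Markov
property.\<close>

lemma measurable_walk:
  "(\<lambda>B. walk x B k) \<in> coord_algebra (count_space UNIV) {i. snd i < k} \<rightarrow>\<^sub>M count_space UNIV"
proof (induction k)
  case (Suc k)
  let ?F = "coord_algebra (count_space UNIV) {i :: int \<times> nat. snd i < Suc k}"
  have [measurable]: "(\<lambda>B. walk x B k) \<in> ?F \<rightarrow>\<^sub>M count_space UNIV"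
    by (rule measurable_coord_algebra_mono[OF _ _ Suc]) auto
  have [measurable]: "(\<lambda>B. B (y, k)) \<in> ?F \<rightarrow>\<^sub>M count_space UNIV" for y
    by (rule measurable_coord_algebra_coordinate) auto
  have "(\<lambda>B. (\<lambda>y B. if B (y, k) then y + 1 else y) (walk x B k) B) \<in> ?F \<rightarrow>\<^sub>M count_space UNIV"
    by (rule measurable_compose_countable) measurable
  then show ?case by simp
qed simp

lemma walk_bounds: "x \<le> walk x B k \<and> walk x B k \<le> x + int k"
  by (induction k) auto

lemma sets_coin_law: "sets (coin_law \<omega>) = sets (PiM UNIV (\<lambda>_. count_space UNIV))"
  unfolding coin_law_def by (rule sets_PiM_cong) auto

lemma measurable_coin [measurable]: "(\<lambda>B. B i) \<in> coin_law \<omega> \<rightarrow>\<^sub>M count_space UNIV"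
  unfolding measurable_cong_sets[OF sets_coin_law refl] by (rule measurable_component_singleton) simp

lemma measurable_coord_coin_law:
  "X \<in> coord_algebra (count_space UNIV) A \<rightarrow>\<^sub>M K \<Longrightarrow> X \<in> coin_law \<omega> \<rightarrow>\<^sub>M K"
  by (rule measurable_from_coord_algebra[of "count_space UNIV"]) auto

lemma prob_space_coin_law: "prob_space (coin_law \<omega>)"
  unfolding coin_law_def by (rule prob_space_PiM) (auto intro: prob_space_measure_pmf)

lemma distr_coin: "distr (coin_law \<omega>) (count_space UNIV) (\<lambda>B. B i) =
    measure_pmf (bernoulli_pmf (\<omega> (fst i, int (snd i))))"
proof -
  let ?p = "\<lambda>(y, k). measure_pmf (bernoulli_pmf (\<omega> (y, int k)))"
  interpret product_prob_space ?p UNIV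
    by (rule product_prob_spaceI) (auto intro: prob_space_measure_pmf)
  have "distr (coin_law \<omega>) (count_space UNIV) (\<lambda>B. B i) = distr (PiM UNIV ?p) (?p i) (\<lambda>B. B i)"
    unfolding coin_law_def by (rule distr_cong) (auto split: prod.split)
  also have "\<dots> = ?p i" by (rule PiM_component) simp
  finally show ?thesis by (simp add: case_prod_beta)
qed

lemma indep_coins:
  "prob_space.indep_vars (coin_law \<omega>) (\<lambda>_. count_space UNIV) (\<lambda>i B. B i) UNIV"
proof -
  interpret prob_space "coin_law \<omega>" by (rule prob_space_coin_law)
  have "distr (coin_law \<omega>) (PiM UNIV (\<lambda>_. count_space UNIV)) (\<lambda>B. \<lambda>i\<in>UNIV. B i) = coin_law \<omega>"
    using distr_id2[OF sets_coin_law[symmetric], of \<omega>] by (simp add: restrict_def)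
  also have "\<dots> = PiM UNIV (\<lambda>i. distr (coin_law \<omega>) (count_space UNIV) (\<lambda>B. B i))"
    unfolding distr_coin unfolding coin_law_def by (intro PiM_cong) auto
  finally show ?thesis
    by (subst indep_vars_iff_distr_eq_PiM') auto
qed

lemma expectation_coin:
  assumes "0 \<le> \<omega> (y, int k)" "\<omega> (y, int k) \<le> 1"
  shows "(\<integral>B. of_bool (\<not> B (y, k)) \<partial>coin_law \<omega>) = 1 - \<omega> (y, int k)"
proof -
  have "(\<integral>B. of_bool (\<not> B (y, k)) \<partial>coin_law \<omega>) =
      (\<integral>b. (of_bool (\<not> b) :: real) \<partial>distr (coin_law \<omega>) (count_space UNIV) (\<lambda>B. B (y, k)))"
    by (subst integral_distr) auto
  also have "\<dots> = 1 - \<omega> (y, int k)"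
    unfolding distr_coin using assms by simp
  finally show ?thesis .
qed

text \<open>The walk is at most \<open>L\<close> after a step iff it was at most \<open>L - 1\<close> before, or was at \<open>L\<close> and the
coin at \<open>L\<close>, which is independent of the position, prevents the jump. So distribution functions are
transported like heights.\<close>

lemma walk_distribution_function:
  assumes "\<And>i. 0 \<le> \<omega> i" "\<And>i. \<omega> i \<le> 1"
  shows "(\<integral>B. of_bool (walk x B k \<le> L) \<partial>coin_law \<omega>) = evolve \<omega> (\<lambda>y. of_bool (x \<le> y)) 0 k L"
proof (induction k arbitrary: L)
  case 0
  interpret prob_space "coin_law \<omega>" by (rule prob_space_coin_law)
  show ?case by (simp add: prob_space)
next
  case (Suc k)
  interpret prob_space "coin_law \<omega>" by (rule prob_space_coin_law)
  define a where "a L B = (of_bool (walk x B k \<le> L) :: real)" for L B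
  define b where "b B = (of_bool (\<not> B (L, k)) :: real)" for B
  let ?F = "coord_algebra (count_space UNIV) {i :: int \<times> nat. snd i < k}"
  have [measurable]: "(\<lambda>B. walk x B k) \<in> ?F \<rightarrow>\<^sub>M count_space UNIV"
    by (rule measurable_walk)
  have aF [measurable]: "a L \<in> borel_measurable ?F" for L
    unfolding a_def[abs_def] by measurable
  have [measurable]: "(\<lambda>B. B (L, k)) \<in> coord_algebra (count_space UNIV) {(L, k)} \<rightarrow>\<^sub>M count_space UNIV"
    by (rule measurable_coord_algebra_coordinate) auto
  have bF: "b \<in> borel_measurable (coord_algebra (count_space UNIV) {(L, k)})"
    unfolding b_def[abs_def] by measurable
  have int_a: "integrable (coin_law \<omega>) (a L)" for L
    by (rule integrable_const_bound[where B = 1, OF _ measurable_coord_coin_law[OF aF]]) (simp add: a_def)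
  have int_b: "integrable (coin_law \<omega>) b"
    by (rule integrable_const_bound[where B = 1, OF _ measurable_coord_coin_law[OF bF]]) (simp add: b_def)
  have "indep_var borel (\<lambda>B. a L B - a (L - 1) B) borel b"
    by (rule indep_var_coord_algebra[OF prob_space_axioms indep_coins _ _ bF,
          where A = "{i. snd i < k}"]) auto
  then have ab: "integrable (coin_law \<omega>) (\<lambda>B. (a L B - a (L - 1) B) * b B)"
    "expectation (\<lambda>B. (a L B - a (L - 1) B) * b B) =
      (expectation (a L) - expectation (a (L - 1))) * expectation b"
    using int_a int_b
    by (simp_all add: indep_var_integrable indep_var_lebesgue_integral)
  have "of_bool (walk x B (Suc k) \<le> L) = a (L - 1) B + (a L B - a (L - 1) B) * b B" for B
    by (cases "walk x B k" L rule: linorder_cases) (auto simp: a_def b_def)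
  then have 1: "(\<integral>B. of_bool (walk x B (Suc k) \<le> L) \<partial>coin_law \<omega>) =
      expectation (a (L - 1)) + (expectation (a L) - expectation (a (L - 1))) * expectation b"
    using ab int_a by simp
  have 2: "expectation b = 1 - \<omega> (L, int k)"
    unfolding b_def[abs_def] using assms by (rule expectation_coin)
  have 3: "expectation (a L) = evolve \<omega> (\<lambda>y. of_bool (x \<le> y)) 0 k L" for L
    unfolding a_def[abs_def] by (rule Suc)
  show ?case unfolding 1 2 3 evolve_Suc by (simp add: algebra_simps)
qed

lemma poisson_law_mean:
  shows "integrable (measure_pmf (poisson_law m)) real"
    and "(\<integral>n. real n \<partial>measure_pmf (poisson_law m)) = max 0 m"
proof -
  have "integrable (measure_pmf (poisson_law m)) real \<and>
    (\<integral>n. real n \<partial>measure_pmf (poisson_law m)) = max 0 m"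
  proof (cases "0 < m")
    case True
    have "(\<lambda>n. m ^ n /\<^sub>R fact n) sums exp m" by (rule exp_converges)
    then have "(\<lambda>n. m * exp (- m) * (m ^ n /\<^sub>R fact n)) sums (m * exp (- m) * exp m)"
      by (rule sums_mult)
    moreover have "m * exp (- m) * (m ^ n /\<^sub>R fact n) = (m ^ Suc n / fact (Suc n) * exp (- m)) * real (Suc n)" for n
      by (simp add: divide_simps del: of_nat_Suc)
    moreover have "m * exp (- m) * exp m = m"
      by (simp add: exp_minus)
    ultimately have "(\<lambda>n. (m ^ Suc n / fact (Suc n) * exp (- m)) * real (Suc n)) sums m"
      by (simp only:)
    then have sums: "(\<lambda>n. pmf (poisson_pmf m) n * real n) sums m"
      using True by (subst (asm) sums_Suc_iff) (simp add: pmf_poisson)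
    have int: "integrable (count_space UNIV) (\<lambda>n. pmf (poisson_pmf m) n *\<^sub>R real n)"
      using sums_summable[OF sums] by (simp add: integrable_count_space_nat_iff abs_mult)
    then have "integrable (measure_pmf (poisson_pmf m)) real"
      by (subst measure_pmf_eq_density, subst integrable_density) (auto simp: mult.commute)
    moreover have "(\<integral>n. real n \<partial>measure_pmf (poisson_pmf m)) = m"
      using integral_count_space_nat[OF int] sums_unique[OF sums]
      by (subst measure_pmf_eq_density, subst integral_density) auto
    ultimately show ?thesis using True by (simp add: poisson_law_def)
  qed (simp add: poisson_law_def integrable_measure_pmf_finite)
  then show "integrable (measure_pmf (poisson_law m)) real"
    "(\<integral>n. real n \<partial>measure_pmf (poisson_law m)) = max 0 m" by auto
qed

definition occupation_law :: "env \<Rightarrow> (int \<Rightarrow> nat) measure" where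
  "occupation_law \<omega> = PiM UNIV (\<lambda>x. measure_pmf (poisson_law (f_density (shift x 0 \<omega>))))"

lemma measurable_occupation [measurable]: "(\<lambda>\<eta>. \<eta> x) \<in> occupation_law \<omega> \<rightarrow>\<^sub>M count_space UNIV"
proof -
  have "(\<lambda>\<eta>. \<eta> x) \<in> occupation_law \<omega> \<rightarrow>\<^sub>M measure_pmf (poisson_law (f_density (shift x 0 \<omega>)))"
    unfolding occupation_law_def by (rule measurable_component_singleton) simp
  then show ?thesis by simp
qed

lemma prob_space_occupation_law: "prob_space (occupation_law \<omega>)"
  unfolding occupation_law_def by (rule prob_space_PiM) (auto intro: prob_space_measure_pmf)

lemma occupation_mean:
  shows "integrable (occupation_law \<omega>) (\<lambda>\<eta>. real (\<eta> x))"
    and "(\<integral>\<eta>. real (\<eta> x) \<partial>occupation_law \<omega>) = max 0 (f_density (shift x 0 \<omega>))"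
proof -
  let ?p = "\<lambda>x. measure_pmf (poisson_law (f_density (shift x 0 \<omega>)))"
  interpret product_prob_space ?p UNIV
    by (rule product_prob_spaceI) (auto intro: prob_space_measure_pmf)
  have d: "distr (occupation_law \<omega>) (?p x) (\<lambda>\<eta>. \<eta> x) = ?p x"
    unfolding occupation_law_def by (rule PiM_component) simp
  have m: "(\<lambda>\<eta>. \<eta> x) \<in> occupation_law \<omega> \<rightarrow>\<^sub>M ?p x"
    unfolding occupation_law_def by (rule measurable_component_singleton) simp
  show "integrable (occupation_law \<omega>) (\<lambda>\<eta>. real (\<eta> x))"
    using integrable_distr_eq[OF m, of real] poisson_law_mean(1) unfolding d by simp
  show "(\<integral>\<eta>. real (\<eta> x) \<partial>occupation_law \<omega>) = max 0 (f_density (shift x 0 \<omega>))"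
    using integral_distr[OF m, of real] poisson_law_mean(2) unfolding d by simp
qed

text \<open>The coins are independent of \<open>\<eta>\<close>, so for fixed \<open>\<eta>\<close> the integral over them is \<open>\<eta> x\<close> times the
mean of \<open>g\<close>. Nonnegativity of \<open>g\<close> lets the same computation serve for integrability.\<close>

lemma quenched_law_site:
  fixes g :: "coins \<Rightarrow> real"
  assumes g [measurable]: "g \<in> borel_measurable (coin_law \<omega>)" and g01: "\<And>B. 0 \<le> g B" "\<And>B. g B \<le> 1"
  shows "integrable (quenched_law \<omega>) (\<lambda>(\<eta>, C). \<Sum>j=1..\<eta> x. g (C (x, j)))"
    and "(\<integral>(\<eta>, C). (\<Sum>j=1..\<eta> x. g (C (x, j))) \<partial>quenched_law \<omega>) =
      max 0 (f_density (shift x 0 \<omega>)) * (\<integral>B. g B \<partial>coin_law \<omega>)"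
proof -
  define N1 where "N1 = occupation_law \<omega>"
  define N2 where "N2 = PiM (UNIV :: (int \<times> nat) set) (\<lambda>_. coin_law \<omega>)"
  have Q: "quenched_law \<omega> = N1 \<Otimes>\<^sub>M N2"
    by (simp add: quenched_law_def N1_def N2_def occupation_law_def)
  interpret C: prob_space "coin_law \<omega>" by (rule prob_space_coin_law)
  interpret N1: prob_space N1 unfolding N1_def by (rule prob_space_occupation_law)
  interpret N2: prob_space N2 unfolding N2_def by (rule prob_space_PiM) (rule prob_space_coin_law)
  interpret pair_sigma_finite N1 N2 ..
  interpret product_prob_space "\<lambda>_ :: int \<times> nat. coin_law \<omega>" UNIV
    by (rule product_prob_spaceI) (rule prob_space_coin_law)
  have comp [measurable]: "(\<lambda>C. C i) \<in> N2 \<rightarrow>\<^sub>M coin_law \<omega>" for i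
    unfolding N2_def by (rule measurable_component_singleton) simp
  have d: "distr N2 (coin_law \<omega>) (\<lambda>C. C i) = coin_law \<omega>" for i
    unfolding N2_def by (rule PiM_component) simp
  have int_g: "integrable (coin_law \<omega>) g"
    by (rule C.integrable_const_bound[where B = 1]) (use g01 in auto)
  have gC: "integrable N2 (\<lambda>C. g (C i))" "(\<integral>C. g (C i) \<partial>N2) = (\<integral>B. g B \<partial>coin_law \<omega>)" for i
    using integrable_distr_eq[OF comp g, of i] integral_distr[OF comp g, of i] int_g unfolding d by auto
  have [measurable]: "(\<lambda>\<eta>. \<eta> x) \<in> N1 \<rightarrow>\<^sub>M count_space UNIV"
    unfolding N1_def by (rule measurable_occupation)
  let ?f = "\<lambda>(\<eta>, C). \<Sum>j=1..\<eta> x. g (C (x, j))"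
  have "(\<lambda>p. (\<lambda>n p. \<Sum>j=1..n. g (snd p (x, j))) (fst p x) p) \<in> borel_measurable (N1 \<Otimes>\<^sub>M N2)"
    by (rule measurable_compose_countable) measurable
  then have meas: "?f \<in> borel_measurable (N1 \<Otimes>\<^sub>M N2)"
    by (simp add: case_prod_beta)
  have inner: "(\<integral>C. ?f (\<eta>, C) \<partial>N2) = real (\<eta> x) * (\<integral>B. g B \<partial>coin_law \<omega>)"
    "(\<integral>C. norm (?f (\<eta>, C)) \<partial>N2) = real (\<eta> x) * (\<integral>B. g B \<partial>coin_law \<omega>)" for \<eta>
    using gC g01 by (simp_all add: sum_nonneg)
  have occ: "integrable N1 (\<lambda>\<eta>. real (\<eta> x))"
    unfolding N1_def by (rule occupation_mean)
  have int: "integrable (N1 \<Otimes>\<^sub>M N2) ?f"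
  proof (rule Fubini_integrable[OF meas])
    show "integrable N1 (\<lambda>\<eta>. \<integral>C. norm (?f (\<eta>, C)) \<partial>N2)"
      unfolding inner using occ by simp
    show "AE \<eta> in N1. integrable N2 (\<lambda>C. ?f (\<eta>, C))"
      using gC by simp
  qed
  then show "integrable (quenched_law \<omega>) ?f" by (simp add: Q)
  have "integral\<^sup>L (N1 \<Otimes>\<^sub>M N2) ?f = (\<integral>\<eta>. \<integral>C. ?f (\<eta>, C) \<partial>N2 \<partial>N1)"
    by (rule integral_fst'[OF int, symmetric])
  also have "\<dots> = max 0 (f_density (shift x 0 \<omega>)) * (\<integral>B. g B \<partial>coin_law \<omega>)"
    unfolding inner using occupation_mean(2)[where x = x and \<omega> = \<omega>] by (simp add: N1_def)
  finally show "integral\<^sup>L (quenched_law \<omega>) ?f =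
      max 0 (f_density (shift x 0 \<omega>)) * (\<integral>B. g B \<partial>coin_law \<omega>)" by (simp add: Q)
qed

text \<open>The sum over all starting points is the mean number of particles at \<open>y\<close> when there is one particle
per site at time \<open>s\<close>, hence an increment of the evolved flat profile.\<close>

lemma quenched_walk_has_sum:
  assumes "\<And>i. 0 \<le> \<omega> i" "\<And>i. \<omega> i \<le> 1"
  shows "((\<lambda>z. pmf (quenched_walk \<omega> s z k) y) has_sum
    (evolve \<omega> of_int s k y - evolve \<omega> of_int s k (y - 1))) UNIV"
proof (induction k arbitrary: y)
  case 0
  have "((\<lambda>z. pmf (quenched_walk \<omega> s z 0) y) has_sum 1) UNIV"
    by (rule has_sum_finite_neutralI[of "{y}"]) (auto simp: pmf_return)
  then show ?case by simp
next
  case (Suc k)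
  let ?u = "\<lambda>y. \<omega> (y, s + int k)"
  have jump: "pmf (jump \<omega> v (s + int k)) y =
      ?u (y - 1) * indicator {y - 1} v + (1 - ?u y) * indicator {y} v" for v
  proof -
    have "pmf (jump \<omega> v (s + int k)) y = measure (measure_pmf (bernoulli_pmf (?u v))) ((\<lambda>b. if b then v + 1 else v) -` {y})"
      unfolding jump_def by (rule pmf_map)
    also have "(\<lambda>b. if b then v + 1 else v) -` {y} =
        (if v = y - 1 then {True} else if v = y then {False} else {})"
      by (auto split: if_splits)
    finally show ?thesis
      using assms by (auto simp: measure_pmf_single)
  qed
  have eq: "pmf (quenched_walk \<omega> s z (Suc k)) y =
      ?u (y - 1) * pmf (quenched_walk \<omega> s z k) (y - 1) + (1 - ?u y) * pmf (quenched_walk \<omega> s z k) y" for z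
  proof -
    have "pmf (quenched_walk \<omega> s z (Suc k)) y = (\<integral>v. pmf (jump \<omega> v (s + int k)) y \<partial>measure_pmf (quenched_walk \<omega> s z k))"
      by (simp add: pmf_bind)
    also have "\<dots> = ?u (y - 1) * measure (measure_pmf (quenched_walk \<omega> s z k)) {y - 1}
        + (1 - ?u y) * measure (measure_pmf (quenched_walk \<omega> s z k)) {y}"
    proof -
      have "integrable (measure_pmf (quenched_walk \<omega> s z k)) (indicat_real {v})" for v
        by (rule measure_pmf.integrable_const_bound[where B = 1]) auto
      then show ?thesis unfolding jump by simp
    qed
    finally show ?thesis by (simp add: measure_pmf_single)
  qed
  have "((\<lambda>z. ?u (y - 1) * pmf (quenched_walk \<omega> s z k) (y - 1) + (1 - ?u y) * pmf (quenched_walk \<omega> s z k) y)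
      has_sum (?u (y - 1) * (evolve \<omega> of_int s k (y - 1) - evolve \<omega> of_int s k (y - 1 - 1))
        + (1 - ?u y) * (evolve \<omega> of_int s k y - evolve \<omega> of_int s k (y - 1)))) UNIV"
    by (intro has_sum_add has_sum_cmult_right Suc)
  then show ?case unfolding eq evolve_Suc by (simp add: algebra_simps)
qed

context fair_environment
begin

text \<open>Shifting the environment moves the flat profile by a constant, which increments do not see.\<close>

lemma f_approx_shift:
  assumes "\<omega> \<in> space P"
  shows "f_approx N (shift x 0 \<omega>) = density_approx N x \<omega>"
proof -
  have "f_approx N (shift x 0 \<omega>) = evolve (shift x 0 \<omega>) of_int (- int N) N 0
      - evolve (shift x 0 \<omega>) of_int (- int N) N (0 - 1)"
    unfolding f_approx_def quenched_prob_def
    using infsumI[OF quenched_walk_has_sum[of "shift x 0 \<omega>" "- int N" N 0]] env_bounds[OF assms]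
    by (simp add: shift_def split_beta)
  also have "\<dots> = density_approx N x \<omega>"
  proof -
    have "evolve \<omega> (\<lambda>y. of_int (y - x)) (- int N) N z = evolve \<omega> of_int (- int N) N z - of_int x" for z
      using evolve_add_const[of \<omega> of_int "- of_int x" "- int N" N z] by simp
    then show ?thesis by (simp add: evolve_shift density_approx_def)
  qed
  finally show ?thesis .
qed

lemma site_density_eq: "\<omega> \<in> space P \<Longrightarrow> max 0 (f_density (shift x 0 \<omega>)) = site_density x \<omega>"
  by (simp add: f_density_def site_density_def f_approx_shift)

text \<open>In the window that influences the height at \<open>(L, k)\<close>, the initial profile is a finite combination of
step functions, one for each site that can contribute to the current.\<close>

lemma initial_profile_window:
  assumes "L - int k \<le> y" "y \<le> L"
  shows "initial_profile y \<omega> = (\<Sum>x\<in>{1..L}. site_density x \<omega> * of_bool (x \<le> y))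
    - (\<Sum>x\<in>{L - int k + 1..0}. site_density x \<omega> * (1 - of_bool (x \<le> y)))"
proof -
  have "(\<Sum>x\<in>{1..L}. site_density x \<omega> * of_bool (x \<le> y)) = (\<Sum>x\<in>{1..y}. site_density x \<omega>)"
    by (rule sum.mono_neutral_cong_right) (use assms in auto)
  moreover have "(\<Sum>x\<in>{L - int k + 1..0}. site_density x \<omega> * (1 - of_bool (x \<le> y))) = (\<Sum>x\<in>{y + 1..0}. site_density x \<omega>)"
    by (rule sum.mono_neutral_cong_right) (use assms in auto)
  ultimately show ?thesis by (simp add: initial_profile_def)
qed

text \<open>The quenched mean current is the combination, with weights \<open>site_density\<close>, of the distribution
functions of walks started to the right of the origin and of the complementary ones to the left. By
linearity it is the evolution of the corresponding combination of step functions.\<close>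

lemma quenched_mean_current_eq:
  assumes "\<omega> \<in> space P"
  shows "quenched_mean_current v n t 0 \<omega> =
    evolve \<omega> (\<lambda>y. initial_profile y \<omega>) 0 (nat \<lfloor>real n * t\<rfloor>) \<lfloor>real n * v * t\<rfloor>"
proof -
  define k where "k = nat \<lfloor>real n * t\<rfloor>"
  define L where "L = \<lfloor>real n * v * t\<rfloor>"
  let ?le = "\<lambda>x B. of_bool (walk x B k \<le> L) :: real" and ?gt = "\<lambda>x B. of_bool (L < walk x B k) :: real"
  note env = env_bounds[OF assms]
  interpret C: prob_space "coin_law \<omega>" by (rule prob_space_coin_law)
  have w [measurable]: "(\<lambda>B. walk x B k) \<in> coin_law \<omega> \<rightarrow>\<^sub>M count_space UNIV" for x
    using measurable_walk by (rule measurable_coord_coin_law)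
  have current: "current v n t 0 \<eta> (\<lambda>x j. walk x (C (x, j))) =
      (\<Sum>x\<in>{1..L}. \<Sum>j=1..\<eta> x. ?le x (C (x, j))) - (\<Sum>x\<in>{L - int k + 1..0}. \<Sum>j=1..\<eta> x. ?gt x (C (x, j)))" for \<eta> C
  proof -
    have far: "x \<le> L" if "walk x B k \<le> L" for x B
      using walk_bounds[of x B k] that by auto
    have near: "L - int k + 1 \<le> x" if "L < walk x B k" for x B
      using walk_bounds[of x B k] that by auto
    have "(\<Sum>\<^sub>\<infinity>x\<in>{0<..}. \<Sum>j=1..\<eta> x. ?le x (C (x, j))) = (\<Sum>\<^sub>\<infinity>x\<in>{1..L}. \<Sum>j=1..\<eta> x. ?le x (C (x, j)))"
      by (rule infsum_cong_neutral) (auto dest: far)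
    moreover have "(\<Sum>\<^sub>\<infinity>x\<in>{..0}. \<Sum>j=1..\<eta> x. ?gt x (C (x, j))) =
        (\<Sum>\<^sub>\<infinity>x\<in>{L - int k + 1..0}. \<Sum>j=1..\<eta> x. ?gt x (C (x, j)))"
      by (rule infsum_cong_neutral) (auto dest: near)
    ultimately show ?thesis
      unfolding current_def k_def[symmetric] L_def[symmetric] by simp
  qed
  have le: "(\<integral>B. ?le x B \<partial>coin_law \<omega>) = evolve \<omega> (\<lambda>y. of_bool (x \<le> y)) 0 k L" for x
    by (rule walk_distribution_function[OF env])
  have gt: "(\<integral>B. ?gt x B \<partial>coin_law \<omega>) = evolve \<omega> (\<lambda>y. 1 - of_bool (x \<le> y)) 0 k L" for x
  proof -
    have int: "integrable (coin_law \<omega>) (?le x)"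
      by (rule C.integrable_const_bound[where B = 1]) auto
    have "?gt x B = 1 - ?le x B" for B by auto
    then have "(\<integral>B. ?gt x B \<partial>coin_law \<omega>) = 1 - (\<integral>B. ?le x B \<partial>coin_law \<omega>)"
      using int by (simp add: C.prob_space)
    then show ?thesis unfolding le by (simp add: evolve_diff evolve_const)
  qed
  define F where "F x p = (\<Sum>j=1..fst p x. ?le x (snd p (x, j)))"
    for x and p :: "(int \<Rightarrow> nat) \<times> (int \<times> nat \<Rightarrow> coins)"
  define G where "G x p = (\<Sum>j=1..fst p x. ?gt x (snd p (x, j)))"
    for x and p :: "(int \<Rightarrow> nat) \<times> (int \<times> nat \<Rightarrow> coins)"
  have F: "integrable (quenched_law \<omega>) (F x)"
    "(\<integral>p. F x p \<partial>quenched_law \<omega>) = site_density x \<omega> * (\<integral>B. ?le x B \<partial>coin_law \<omega>)" for x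
    using quenched_law_site[of "?le x" \<omega> x] site_density_eq[OF assms]
    unfolding F_def[abs_def] case_prod_beta by simp_all
  have G: "integrable (quenched_law \<omega>) (G x)"
    "(\<integral>p. G x p \<partial>quenched_law \<omega>) = site_density x \<omega> * (\<integral>B. ?gt x B \<partial>coin_law \<omega>)" for x
    using quenched_law_site[of "?gt x" \<omega> x] site_density_eq[OF assms]
    unfolding G_def[abs_def] case_prod_beta by simp_all
  have "quenched_mean_current v n t 0 \<omega> =
      (\<integral>p. (\<Sum>x\<in>{1..L}. F x p) - (\<Sum>x\<in>{L - int k + 1..0}. G x p) \<partial>quenched_law \<omega>)"
    unfolding quenched_mean_current_def current F_def G_def case_prod_beta ..
  also have "\<dots> = (\<Sum>x\<in>{1..L}. site_density x \<omega> * (\<integral>B. ?le x B \<partial>coin_law \<omega>))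
      - (\<Sum>x\<in>{L - int k + 1..0}. site_density x \<omega> * (\<integral>B. ?gt x B \<partial>coin_law \<omega>))"
    using F G by simp
  also have "\<dots> = evolve \<omega> (\<lambda>y. (\<Sum>x\<in>{1..L}. site_density x \<omega> * of_bool (x \<le> y))
      - (\<Sum>x\<in>{L - int k + 1..0}. site_density x \<omega> * (1 - of_bool (x \<le> y)))) 0 k L"
    unfolding le gt evolve_diff evolve_sum evolve_cmult ..
  also have "\<dots> = evolve \<omega> (\<lambda>y. initial_profile y \<omega>) 0 k L"
    by (rule evolve_cong_local) (use initial_profile_window in auto)
  finally show ?thesis by (simp add: k_def L_def)
qed

end

section \<open>The covariance of the current\<close>

theorem theorem1p7:
  fixes P :: "env measure" and s t :: real
  assumes "iid_environment P"
    and "p_zero P = 1 / 2" and "p_one P = 1 / 2"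
    and "0 < s" and "s \<le> t"
  shows "(\<lambda>n. 1 / sqrt (real n) *
            covariance P (quenched_mean_current (speed P) n s 0)
                         (quenched_mean_current (speed P) n t 0))
         \<longlonglongrightarrow> 1 / (2 * sqrt (2 * pi)) * (1 / 4 * inverse (alpha P) - 1)
               * (sqrt t + sqrt s - sqrt (t - s))"
proof -
  interpret fair_environment P
    using assms by (simp add: fair_environment_def fair_environment_axioms_def)
  \<comment> \<open>Numbers of steps, target sites, and steps between the two times. Rounding keeps \<open>2 * x - k\<close>
    bounded, which is all that the asymptotics ask for.\<close>
  define k where "k t n = nat \<lfloor>real n * t\<rfloor>" for t n
  define x where "x t n = \<lfloor>real n * (1 / 2) * t\<rfloor>" for t n
  define l where "l n = k t n - k s n" for n
  have "0 < t" using assms by simp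
  have k_bounds: "real n * u - 1 < real (k u n) \<and> real (k u n) \<le> real n * u" if "0 < u" for u n
  proof -
    have "0 \<le> real n * u" using that by simp
    then have "real (k u n) = of_int \<lfloor>real n * u\<rfloor>" by (simp add: k_def)
    then show ?thesis by linarith
  qed
  have x_bounds: "real n * u / 2 - 1 < of_int (x u n) \<and> of_int (x u n) \<le> real n * u / 2" for u n
    unfolding x_def by (simp, linarith)
  have k_le: "k s n \<le> k t n" for n
    unfolding k_def using \<open>s \<le> t\<close> by (intro nat_mono floor_mono mult_left_mono) auto
  have k_lim: "(\<lambda>n. real (k u n) / real n) \<longlonglongrightarrow> u" if "0 < u" for u
  proof (rule real_tendsto_sandwich)
    show "\<forall>\<^sub>F n in sequentially. u - 1 / real n \<le> real (k u n) / real n"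
      using eventually_gt_at_top[of 0]
    proof eventually_elim
      case (elim n)
      have "(real n * u - 1) / real n \<le> real (k u n) / real n"
        using k_bounds[OF that, of n] by (intro divide_right_mono) auto
      then show ?case using elim by (simp add: diff_divide_distrib)
    qed
    show "\<forall>\<^sub>F n in sequentially. real (k u n) / real n \<le> u"
      using eventually_gt_at_top[of 0]
    proof eventually_elim
      case (elim n)
      then show ?case using k_bounds[OF that, of n] by (simp add: field_simps)
    qed
    show "(\<lambda>n. u - 1 / real n) \<longlonglongrightarrow> u" by real_asymp
  qed simp
  have l: "real (l n) = real (k t n) - real (k s n)" for n
    using k_le by (simp add: l_def of_nat_diff)
  have l_lim: "(\<lambda>n. real (l n) / real n) \<longlonglongrightarrow> t - s"
    using tendsto_diff[OF k_lim[OF \<open>0 < t\<close>] k_lim[OF \<open>0 < s\<close>]] by (simp add: l diff_divide_distrib)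
  have near: "\<bar>2 * of_int (x u n) - real (k u n)\<bar> \<le> 2" if "0 < u" for u n
    using k_bounds[OF that, of n] x_bounds[of n u] by linarith
  have lim: "(\<lambda>n. mean_abs (k u n) (x u n) / sqrt (real n)) \<longlonglongrightarrow> sqrt (u / (2 * pi))" if "0 < u" for u
    by (rule mean_abs_asymptotics[OF k_lim[OF that] near[OF that]])
  have lim_diff: "(\<lambda>n. mean_abs (l n) (x t n - x s n) / sqrt (real n)) \<longlonglongrightarrow> sqrt ((t - s) / (2 * pi))"
  proof (rule mean_abs_asymptotics[OF l_lim])
    show "\<bar>2 * of_int (x t n - x s n) - real (l n)\<bar> \<le> 4" for n
      using near[OF \<open>0 < t\<close>, of n] near[OF \<open>0 < s\<close>, of n] unfolding l by simp
  qed
  have current: "quenched_mean_current (speed P) n u 0 \<omega> = evolve \<omega> (\<lambda>y. initial_profile y \<omega>) 0 (k u n) (x u n)"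
    if "\<omega> \<in> space P" for u n \<omega>
  proof -
    have speed: "speed P = 1 / 2" using assms(3) by (simp add: speed_def)
    show ?thesis
      unfolding speed k_def x_def using quenched_mean_current_eq[OF that, of "1 / 2" n u] by simp
  qed
  have cov: "covariance P (quenched_mean_current (speed P) n s 0) (quenched_mean_current (speed P) n t 0) =
      sigma2 / 2 * (mean_abs (k s n) (x s n) + mean_abs (k t n) (x t n) - mean_abs (l n) (x t n - x s n))" for n
  proof -
    have "covariance P (quenched_mean_current (speed P) n s 0) (quenched_mean_current (speed P) n t 0) =
        covariance P (\<lambda>\<omega>. evolve \<omega> (\<lambda>y. initial_profile y \<omega>) 0 (k s n) (x s n))
          (\<lambda>\<omega>. evolve \<omega> (\<lambda>y. initial_profile y \<omega>) 0 (k s n + l n) (x t n))"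
      unfolding covariance_def using k_le[of n]
      by (simp add: current l_def cong: Bochner_Integration.integral_cong)
    then show ?thesis
      unfolding covariance_evolve_initial using k_le[of n] by (simp add: l_def)
  qed
  have "(\<lambda>n. sigma2 / 2 * (mean_abs (k s n) (x s n) / sqrt (real n) + mean_abs (k t n) (x t n) / sqrt (real n)
      - mean_abs (l n) (x t n - x s n) / sqrt (real n)))
      \<longlonglongrightarrow> sigma2 / 2 * (sqrt (s / (2 * pi)) + sqrt (t / (2 * pi)) - sqrt ((t - s) / (2 * pi)))"
    by (intro tendsto_intros lim lim_diff \<open>0 < s\<close> \<open>0 < t\<close>)
  moreover have "sigma2 / 2 * (sqrt (s / (2 * pi)) + sqrt (t / (2 * pi)) - sqrt ((t - s) / (2 * pi))) =
      1 / (2 * sqrt (2 * pi)) * (1 / 4 * inverse (alpha P) - 1) * (sqrt t + sqrt s - sqrt (t - s))"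
  proof -
    have sigma2: "1 / 4 * inverse (alpha P) - 1 = sigma2"
      using alpha_pos by (simp add: sigma2_def beta_def field_simps)
    have "u / 2 * (a / d + b / d - c / d) = 1 / (2 * d) * u * (b + a - c)" for a b c d u :: real
      by (simp add: add_divide_distrib diff_divide_distrib algebra_simps)
    then show ?thesis
      unfolding sigma2 real_sqrt_divide .
  qed
  moreover have "1 / r * (u / 2 * (a + b - c)) = u / 2 * (a / r + b / r - c / r)" for a b c r u :: real
    by (simp add: add_divide_distrib diff_divide_distrib algebra_simps)
  ultimately show ?thesis
    unfolding cov by (simp only:)
qed

end
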